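(* Two parallelepipeds with equal volumes of the corresponding faces (of all dimensions) are isometric. That is: let $H$ be a real Hilbert space and let $(v_{1},\dots,v_{n})$ and $(w_{1},\dots,w_{n})$ be two linearly independent families of $n$ vectors in $H$ such that $V(v_{i_{1}},\dots,v_{i_{k}})=V(w_{i_{1}},\dots,w_{i_{k}})$ for every nonempty subset $\{i_{1},\dots,i_{k}\}$ of $\{1,\dots,n\}$ (with $i_1,\dots,i_k$ distinct). Then the parallelepipeds $P(v_{1},\dots,v_{n})$ and $P(w_{1},\dots,w_{n})$ are isometric.
   Context: For linearly independent vectors $v_{1},\dots,v_{k}$ in a real Hilbert space $H$, the parallelepiped they define is $P(v_{1},\dots,v_{k})=\{\sum_{i=1}^{k}\alpha_{i}v_{i} : \alpha_{i}\in[0,1]\}$, and $V(v_{1},\dots,v_{k})$ denotes its $k$-dimensional volume (Hausdorff measure), so that $V(v_{1},\dots,v_{k})^{2}=\det[\langle v_{i},v_{j}\rangle]_{i,j=1}^{k}$. For a subfamily, $P(v_{i_{1}},\dots,v_{i_{k}})$ is a face of $P(v_{1},\dots,v_{n})$; its corresponding face of $P(w_{1},\dots,w_{n})$ is $P(w_{i_{1}},\dots,w_{i_{k}})$. Two subsets of $H$ are isometric if there is a distance-preserving bijection between them. *)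

theory Defs
  imports "HOL-Analysis.Analysis"
begin

text \<open>
  Linear independence of an indexed family. Injectivity is required because
  \<^const>\<open>independent\<close> speaks about sets and would not see repeated members.
\<close>

definition independent_family :: "'i set \<Rightarrow> ('i \<Rightarrow> 'a::real_vector) \<Rightarrow> bool" where
  "independent_family I v \<longleftrightarrow> inj_on v I \<and> independent (v ` I)"

definition parallelepiped :: "'i set \<Rightarrow> ('i \<Rightarrow> 'a::real_vector) \<Rightarrow> 'a set" where
  "parallelepiped I v = {(\<Sum>i\<in>I. \<alpha> i *\<^sub>R v i) | \<alpha>. \<forall>i\<in>I. 0 \<le> \<alpha> i \<and> \<alpha> i \<le> 1}"

text \<open>
  The size-\<open>\<delta>\<close> premeasure of the \<open>k\<close>-dimensional Hausdorff measure: the infimum, over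
  countable covers of \<open>A\<close> by sets of diameter at most \<open>\<delta>\<close>, of the total volume of
  \<open>k\<close>-dimensional balls of the same diameters as the covering sets. Finite covers are
  included by padding with empty sets, which therefore weigh 0 also for \<open>k = 0\<close>.
  Boundedness is required because \<^const>\<open>diameter\<close> is unspecified on unbounded sets.
  If there is no such cover, the infimum is \<open>\<infinity>\<close>.
\<close>

definition hausdorff_premeasure :: "real \<Rightarrow> nat \<Rightarrow> 'a::metric_space set \<Rightarrow> ennreal" where
  "hausdorff_premeasure \<delta> k A =
     Inf {(\<Sum>j. if U j = {} then 0
                else ennreal (unit_ball_vol (real k) * (diameter (U j) / 2) ^ k)) | U :: nat \<Rightarrow> 'a set.
            A \<subseteq> (\<Union>j. U j) \<and> (\<forall>j. bounded (U j) \<and> diameter (U j) \<le> \<delta>)}"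

text \<open>
  The limit for \<open>\<delta> \<rightarrow> 0\<close> is a supremum because the premeasure grows as \<open>\<delta>\<close> decreases.
  The normalisation by the volume of the unit ball is the one for which the
  measure on \<open>k\<close>-dimensional Euclidean space is Lebesgue measure.
\<close>

definition hausdorff_measure :: "nat \<Rightarrow> 'a::metric_space set \<Rightarrow> ennreal" where
  "hausdorff_measure k A = (SUP \<delta>\<in>{0<..}. hausdorff_premeasure \<delta> k A)"

definition parallelepiped_volume :: "'i set \<Rightarrow> ('i \<Rightarrow> 'a::real_normed_vector) \<Rightarrow> ennreal" where
  "parallelepiped_volume I v = hausdorff_measure (card I) (parallelepiped I v)"

definition isometric :: "'a::metric_space set \<Rightarrow> 'b::metric_space set \<Rightarrow> bool" where
  "isometric S T \<longleftrightarrow>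
     (\<exists>f. bij_betw f S T \<and> (\<forall>x\<in>S. \<forall>y\<in>S. dist (f x) (f y) = dist x y))"

end

theory Submission
  imports Defs
begin

text \<open>
  The Hausdorff volume of a parallelepiped is \<open>c * sqrt (det G)\<close>, where \<open>G\<close> is the Gram matrix
  and \<open>0 < c < \<infinity>\<close> depends only on the dimension: cutting and translating show that the volume is
  linear in each edge length and invariant under shears, so Gram-Schmidt reduces it to a cube.
  Hence equal face volumes mean that the Gram matrices of \<open>v\<close> and \<open>w\<close> have equal principal minors.
  Two such symmetric matrices are conjugate by a diagonal matrix of signs: otherwise some shortest
  cycle of nonzero entries would carry a product of signs \<open>-1\<close>, and the principal minors on that
  chordless cycle would differ. Finally, changing the sign of an edge vector only translates the
  parallelepiped.
\<close>

subsection \<open>Hausdorff measure\<close>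

text \<open>Volumes enter through subadditivity, monotonicity and the Lipschitz bound of the
  Hausdorff measure, so cutting a set into pieces gives an inequality in one direction. The reverse
  inequality comes from an operation whose total effect is known: a homothety by \<open>N\<close>
  acts with the factor \<open>N ^ k\<close> in dimension \<open>k\<close>, and a shear is undone by
  a shear. The constant \<open>c\<close> is the volume of an orthonormal cube and is never
  evaluated. Orthonormal cubes of equal dimension are isometric, so \<open>c\<close> cancels when
  \<open>v\<close> is compared with \<open>w\<close>, provided that
  \<open>0 < c < \<infinity>\<close>. A single covering set gives the upper bound; the lower bound
  has to control arbitrary covers and is reduced to counting grid points in finite ones. For the
  signs, the index set grows by one index at a time. The two matrices then already agree off the new
  row and column, and a bad cycle passes through the new index with exactly one flipped edge, which
  allows the two minors to be compared term by term.\<close>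

definition hausdorff_weight :: "nat \<Rightarrow> 'a::metric_space set \<Rightarrow> ennreal" where
  "hausdorff_weight k U =
     (if U = {} then 0 else ennreal (unit_ball_vol (real k) * (diameter U / 2) ^ k))"

lemma hausdorff_premeasure_le:
  assumes "A \<subseteq> (\<Union>j. U j)" "\<And>j::nat. bounded (U j)" "\<And>j. diameter (U j) \<le> \<delta>"
  shows "hausdorff_premeasure \<delta> k A \<le> (\<Sum>j. hausdorff_weight k (U j))"
  unfolding hausdorff_premeasure_def hausdorff_weight_def
  using assms by (intro Inf_lower) blast

lemma hausdorff_premeasure_greatest:
  assumes "\<And>U::nat \<Rightarrow> _. A \<subseteq> (\<Union>j. U j) \<Longrightarrow> (\<And>j. bounded (U j)) \<Longrightarrow> (\<And>j. diameter (U j) \<le> \<delta>)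
             \<Longrightarrow> b \<le> (\<Sum>j. hausdorff_weight k (U j))"
  shows "b \<le> hausdorff_premeasure \<delta> k A"
  unfolding hausdorff_premeasure_def
  using assms[unfolded hausdorff_weight_def] by (intro Inf_greatest) blast

lemma hausdorff_premeasure_approx:
  assumes "hausdorff_premeasure \<delta> k A < b"
  obtains U :: "nat \<Rightarrow> _" where "A \<subseteq> (\<Union>j. U j)" "\<And>j. bounded (U j)"
    "\<And>j. diameter (U j) \<le> \<delta>" "(\<Sum>j. hausdorff_weight k (U j)) < b"
  using assms unfolding hausdorff_premeasure_def Inf_less_iff hausdorff_weight_def by blast

lemma hausdorff_premeasure_mono:
  assumes "A \<subseteq> B"
  shows "hausdorff_premeasure \<delta> k A \<le> hausdorff_premeasure \<delta> k B"
  using assms by (intro hausdorff_premeasure_greatest hausdorff_premeasure_le) auto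

text \<open>Two countable covers are merged into one sequence by alternating their members; this
  computes the weight of the merged cover.\<close>

lemma suminf_ennreal_interleave:
  fixes f g :: "nat \<Rightarrow> ennreal"
  shows "(\<Sum>n. if even n then f (n div 2) else g (n div 2)) = (\<Sum>n. f n) + (\<Sum>n. g n)"
proof -
  let ?h = "\<lambda>n. if even n then f (n div 2) else g (n div 2)"
  have "(\<lambda>n. sum ?h {n * 2 ..< n * 2 + 2}) sums (\<Sum>n. ?h n)"
    by (rule sums_group) (auto intro: summable_sums)
  moreover have "sum ?h {n * 2 ..< n * 2 + 2} = f n + g n" for n
  proof -
    have "{n * 2 ..< n * 2 + 2} = {2 * n, Suc (2 * n)}" by auto
    then show ?thesis by simp
  qed
  ultimately have "(\<lambda>n. f n + g n) sums (\<Sum>n. ?h n)" by simp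
  then show ?thesis by (simp add: suminf_add sums_iff)
qed

lemma hausdorff_premeasure_Un:
  "hausdorff_premeasure \<delta> k (A \<union> B) \<le> hausdorff_premeasure \<delta> k A + hausdorff_premeasure \<delta> k B"
proof (rule ennreal_le_epsilon)
  fix e :: real
  assume fin: "hausdorff_premeasure \<delta> k A + hausdorff_premeasure \<delta> k B < top" and e: "0 < e"
  have "hausdorff_premeasure \<delta> k A < hausdorff_premeasure \<delta> k A + ennreal (e / 2)"
    using fin e by (auto simp: less_top)
  then obtain U where U: "A \<subseteq> (\<Union>j. U j)" "\<And>j. bounded (U j)" "\<And>j. diameter (U j) \<le> \<delta>"
    "(\<Sum>j. hausdorff_weight k (U j)) < hausdorff_premeasure \<delta> k A + ennreal (e / 2)"
    by (rule hausdorff_premeasure_approx) (rule that; assumption)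
  have "hausdorff_premeasure \<delta> k B < hausdorff_premeasure \<delta> k B + ennreal (e / 2)"
    using fin e by (auto simp: less_top)
  then obtain V where V: "B \<subseteq> (\<Union>j. V j)" "\<And>j. bounded (V j)" "\<And>j. diameter (V j) \<le> \<delta>"
    "(\<Sum>j. hausdorff_weight k (V j)) < hausdorff_premeasure \<delta> k B + ennreal (e / 2)"
    by (rule hausdorff_premeasure_approx) (rule that; assumption)
  define W where "W n = (if even n then U (n div 2) else V (n div 2))" for n
  have W: "W (2 * j) = U j" "W (Suc (2 * j)) = V j" for j
    by (simp_all add: W_def)
  have "U j \<subseteq> (\<Union>j. W j)" "V j \<subseteq> (\<Union>j. W j)" for j
    unfolding W[of j, symmetric] by blast+
  then have "A \<union> B \<subseteq> (\<Union>j. W j)"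
    by (intro Un_least order_trans[OF U(1)] order_trans[OF V(1)] UN_least)
  then have "hausdorff_premeasure \<delta> k (A \<union> B) \<le> (\<Sum>j. hausdorff_weight k (W j))"
    using U(2,3) V(2,3) by (intro hausdorff_premeasure_le) (simp_all add: W_def)
  also have "\<dots> = (\<Sum>n. if even n then hausdorff_weight k (U (n div 2)) else hausdorff_weight k (V (n div 2)))"
    by (intro suminf_cong) (simp add: W_def)
  also have "\<dots> = (\<Sum>j. hausdorff_weight k (U j)) + (\<Sum>j. hausdorff_weight k (V j))"
    by (rule suminf_ennreal_interleave)
  also have "\<dots> \<le> (hausdorff_premeasure \<delta> k A + ennreal (e / 2)) + (hausdorff_premeasure \<delta> k B + ennreal (e / 2))"
    using U(4) V(4) by (intro add_mono) auto
  also have "\<dots> = hausdorff_premeasure \<delta> k A + hausdorff_premeasure \<delta> k B + (ennreal (e / 2) + ennreal (e / 2))"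
    by (simp add: ac_simps)
  also have "ennreal (e / 2) + ennreal (e / 2) = ennreal e"
    using e by (simp flip: ennreal_plus)
  finally show "hausdorff_premeasure \<delta> k (A \<union> B)
      \<le> hausdorff_premeasure \<delta> k A + hausdorff_premeasure \<delta> k B + ennreal e" .
qed

lemma hausdorff_premeasure_lipschitz:
  fixes f :: "'a::metric_space \<Rightarrow> 'b::metric_space"
  assumes L: "L > 0" and f: "\<And>x y. x \<in> A \<Longrightarrow> y \<in> A \<Longrightarrow> dist (f x) (f y) \<le> L * dist x y"
  shows "hausdorff_premeasure (L * \<delta>) k (f ` A) \<le> ennreal (L ^ k) * hausdorff_premeasure \<delta> k A"
proof -
  \<comment> \<open>The factor is moved to the left in inverted form, so that the right-hand side is
    a bare infimum and \<open>hausdorff_premeasure_greatest\<close> applies.\<close>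
  have "ennreal (1 / L ^ k) * hausdorff_premeasure (L * \<delta>) k (f ` A) \<le> hausdorff_premeasure \<delta> k A"
  proof (rule hausdorff_premeasure_greatest)
    fix U :: "nat \<Rightarrow> 'a set"
    assume U: "A \<subseteq> (\<Union>j. U j)" "\<And>j. bounded (U j)" "\<And>j. diameter (U j) \<le> \<delta>"
    \<comment> \<open>The bound on \<open>f\<close> holds only on \<open>A\<close>, so the pieces
      are cut down to \<open>A\<close> before they are mapped.\<close>
    define V where "V j = f ` (U j \<inter> A)" for j
    have V_dist: "dist x y \<le> L * diameter (U j)" if xy: "x \<in> V j" "y \<in> V j" for x y j
    proof -
      obtain a b where ab: "x = f a" "y = f b" "a \<in> U j \<inter> A" "b \<in> U j \<inter> A"
        using xy unfolding V_def by blast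
      then have "dist x y \<le> L * dist a b" using f by auto
      also have "\<dots> \<le> L * diameter (U j)"
        using ab L U(2) by (intro mult_left_mono diameter_bounded_bound) auto
      finally show ?thesis .
    qed
    have Vb: "bounded (V j)" for j
      using V_dist by (auto simp: bounded_two_points)
    have Vd: "diameter (V j) \<le> L * diameter (U j)" for j
      using V_dist[of _ j] L diameter_ge_0[OF U(2)[of j]]
      by (auto simp: diameter_def[of "V j"] intro!: cSUP_least)
    have w: "ennreal (1 / L ^ k) * hausdorff_weight k (V j) \<le> hausdorff_weight k (U j)" for j
    proof (cases "V j = {}")
      case False
      then have "U j \<noteq> {}" by (auto simp: V_def)
      have "(diameter (V j) / 2) ^ k \<le> (L * (diameter (U j) / 2)) ^ k"
        using Vd[of j] diameter_ge_0[OF Vb[of j]] by (intro power_mono) auto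
      then have "(diameter (V j) / 2) ^ k \<le> L ^ k * (diameter (U j) / 2) ^ k"
        by (simp only: power_mult_distrib)
      then have "(1 / L ^ k) * (unit_ball_vol (real k) * (diameter (V j) / 2) ^ k)
          \<le> (1 / L ^ k) * (unit_ball_vol (real k) * (L ^ k * (diameter (U j) / 2) ^ k))"
        using L by (intro mult_left_mono) auto
      also have "\<dots> = unit_ball_vol (real k) * (diameter (U j) / 2) ^ k"
        using L by simp
      finally have "ennreal (1 / L ^ k * (unit_ball_vol (real k) * (diameter (V j) / 2) ^ k))
          \<le> ennreal (unit_ball_vol (real k) * (diameter (U j) / 2) ^ k)"
        by (rule ennreal_leI)
      then show ?thesis
        using False \<open>U j \<noteq> {}\<close> L diameter_ge_0[OF Vb[of j]]
        by (subst (asm) ennreal_mult) (auto simp: hausdorff_weight_def)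
    qed (simp add: hausdorff_weight_def)
    have "hausdorff_premeasure (L * \<delta>) k (f ` A) \<le> (\<Sum>j. hausdorff_weight k (V j))"
    proof (rule hausdorff_premeasure_le)
      show "f ` A \<subseteq> (\<Union>j. V j)" using U(1) unfolding V_def by blast
      show "diameter (V j) \<le> L * \<delta>" for j
        using Vd[of j] U(3)[of j] L by (meson mult_left_mono less_imp_le order_trans)
    qed (rule Vb)
    then have "ennreal (1 / L ^ k) * hausdorff_premeasure (L * \<delta>) k (f ` A)
        \<le> ennreal (1 / L ^ k) * (\<Sum>j. hausdorff_weight k (V j))"
      by (rule mult_left_mono) simp
    also have "\<dots> = (\<Sum>j. ennreal (1 / L ^ k) * hausdorff_weight k (V j))" by simp
    also have "\<dots> \<le> (\<Sum>j. hausdorff_weight k (U j))"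
      by (intro suminf_le w) auto
    finally show "ennreal (1 / L ^ k) * hausdorff_premeasure (L * \<delta>) k (f ` A)
        \<le> (\<Sum>j. hausdorff_weight k (U j))" .
  qed
  then have "ennreal (L ^ k) * (ennreal (1 / L ^ k) * hausdorff_premeasure (L * \<delta>) k (f ` A))
      \<le> ennreal (L ^ k) * hausdorff_premeasure \<delta> k A"
    by (rule mult_left_mono) simp
  moreover have "ennreal (L ^ k) * ennreal (1 / L ^ k) = 1"
    using L by (simp flip: ennreal_mult'')
  ultimately show ?thesis by (simp flip: mult.assoc)
qed

lemma hausdorff_premeasure_translation:
  fixes A :: "'a::real_normed_vector set"
  shows "hausdorff_premeasure \<delta> k ((+) a ` A) \<le> hausdorff_premeasure \<delta> k A"
  using hausdorff_premeasure_lipschitz[of 1 A "(+) a" \<delta> k] by simp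

lemma hausdorff_premeasure_le_measure:
  "\<delta> > 0 \<Longrightarrow> hausdorff_premeasure \<delta> k A \<le> hausdorff_measure k A"
  unfolding hausdorff_measure_def by (rule SUP_upper) simp

lemma hausdorff_measure_mono: "A \<subseteq> B \<Longrightarrow> hausdorff_measure k A \<le> hausdorff_measure k B"
  unfolding hausdorff_measure_def
  by (intro SUP_mono') (rule hausdorff_premeasure_mono)

lemma hausdorff_measure_lipschitz:
  fixes f :: "'a::metric_space \<Rightarrow> 'b::metric_space"
  assumes L: "L > 0" and f: "\<And>x y. x \<in> A \<Longrightarrow> y \<in> A \<Longrightarrow> dist (f x) (f y) \<le> L * dist x y"
  shows "hausdorff_measure k (f ` A) \<le> ennreal (L ^ k) * hausdorff_measure k A"
  unfolding hausdorff_measure_def[of k "f ` A"]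
proof (rule SUP_least)
  fix \<delta> :: real assume "\<delta> \<in> {0<..}"
  then have \<delta>: "\<delta> > 0" by simp
  have "hausdorff_premeasure (L * (\<delta> / L)) k (f ` A) \<le> ennreal (L ^ k) * hausdorff_premeasure (\<delta> / L) k A"
    by (rule hausdorff_premeasure_lipschitz[OF assms])
  also have "\<dots> \<le> ennreal (L ^ k) * hausdorff_measure k A"
    using \<delta> L by (intro mult_left_mono hausdorff_premeasure_le_measure) auto
  finally show "hausdorff_premeasure \<delta> k (f ` A) \<le> ennreal (L ^ k) * hausdorff_measure k A"
    using L by simp
qed

lemma hausdorff_measure_translation:
  fixes A :: "'a::real_normed_vector set"
  shows "hausdorff_measure k ((+) a ` A) \<le> hausdorff_measure k A"
  using hausdorff_measure_lipschitz[of 1 A "(+) a" k] by simp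

lemma isometric_hausdorff_measure_le:
  assumes "isometric A B"
  shows "hausdorff_measure k B \<le> hausdorff_measure k A"
proof -
  obtain f where "bij_betw f A B" "\<forall>x\<in>A. \<forall>y\<in>A. dist (f x) (f y) = dist x y"
    using assms unfolding isometric_def by blast
  then show ?thesis
    using hausdorff_measure_lipschitz[of 1 A f k] by (simp add: bij_betw_def)
qed

subsection \<open>Volume of parallelepipeds\<close>

lemma parallelepiped_cong:
  assumes "\<And>i. i \<in> I \<Longrightarrow> v i = w i"
  shows "parallelepiped I v = parallelepiped I w"
proof -
  have "(\<Sum>i\<in>I. a i *\<^sub>R v i) = (\<Sum>i\<in>I. a i *\<^sub>R w i)" for a
    using assms by (intro sum.cong) auto
  then show ?thesis by (simp add: parallelepiped_def)
qed

lemma parallelepipedI: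
  assumes "\<And>i. i \<in> I \<Longrightarrow> 0 \<le> \<alpha> i" "\<And>i. i \<in> I \<Longrightarrow> \<alpha> i \<le> 1"
  shows "(\<Sum>i\<in>I. \<alpha> i *\<^sub>R v i) \<in> parallelepiped I v"
  using assms unfolding parallelepiped_def by blast

lemma parallelepipedE:
  assumes "x \<in> parallelepiped I v"
  obtains \<alpha> where "x = (\<Sum>i\<in>I. \<alpha> i *\<^sub>R v i)" "\<And>i. i \<in> I \<Longrightarrow> 0 \<le> \<alpha> i" "\<And>i. i \<in> I \<Longrightarrow> \<alpha> i \<le> 1"
  using assms unfolding parallelepiped_def by blast

lemma parallelepiped_scaleR:
  "parallelepiped I (\<lambda>i. r *\<^sub>R v i) = (*\<^sub>R) r ` parallelepiped I v"
proof -
  have "(\<Sum>i\<in>I. a i *\<^sub>R r *\<^sub>R v i) = r *\<^sub>R (\<Sum>i\<in>I. a i *\<^sub>R v i)" for a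
    by (simp add: scaleR_sum_right mult.commute)
  then show ?thesis unfolding parallelepiped_def by auto
qed

lemma bounded_parallelepiped:
  fixes v :: "'i \<Rightarrow> 'a::real_normed_vector"
  shows "bounded (parallelepiped I v)"
proof (rule boundedI)
  fix x assume "x \<in> parallelepiped I v"
  then obtain \<alpha> where \<alpha>: "x = (\<Sum>i\<in>I. \<alpha> i *\<^sub>R v i)" "\<And>i. i \<in> I \<Longrightarrow> 0 \<le> \<alpha> i" "\<And>i. i \<in> I \<Longrightarrow> \<alpha> i \<le> 1"
    by (rule parallelepipedE) (rule that; assumption)
  show "norm x \<le> (\<Sum>i\<in>I. norm (v i))"
    unfolding \<alpha>(1) using \<alpha>(2,3) by (intro sum_norm_le) (simp add: mult_left_le_one_le)
qed

section \<open>Cutting a parallelepiped into translated slabs\<close>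

lemma sum_scaleR_fun_upd:
  assumes "finite I" "i \<in> I"
  shows "(\<Sum>k\<in>I. a k *\<^sub>R (v(i := x)) k) = a i *\<^sub>R x + (\<Sum>k\<in>I - {i}. a k *\<^sub>R v k)"
proof -
  have "(\<Sum>k\<in>I - {i}. a k *\<^sub>R (v(i := x)) k) = (\<Sum>k\<in>I - {i}. a k *\<^sub>R v k)"
    by (intro sum.cong) auto
  then show ?thesis using assms by (subst sum.remove[of _ i]) auto
qed

text \<open>The integer part of the stretched \<open>i\<close>-th coordinate selects the translate,
  and the remainder is the new coordinate.\<close>

lemma parallelepiped_slabs:
  assumes I: "finite I" "i \<in> I" and N: "N > 0"
  shows "parallelepiped I (v(i := real N *\<^sub>R v i)) \<subseteq> (\<Union>l<N. (+) (real l *\<^sub>R v i) ` parallelepiped I v)"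
proof
  fix x assume "x \<in> parallelepiped I (v(i := real N *\<^sub>R v i))"
  then obtain \<alpha> where \<alpha>: "x = (\<Sum>k\<in>I. \<alpha> k *\<^sub>R (v(i := real N *\<^sub>R v i)) k)"
    "\<And>k. k \<in> I \<Longrightarrow> 0 \<le> \<alpha> k" "\<And>k. k \<in> I \<Longrightarrow> \<alpha> k \<le> 1"
    by (rule parallelepipedE) (rule that; assumption)
  have \<alpha>N: "0 \<le> \<alpha> i * N" "\<alpha> i * N \<le> N"
    using \<alpha>(2,3)[OF I(2)] by (auto simp: mult_left_le_one_le)
  \<comment> \<open>The slab number must stay below \<open>N\<close>. At
    \<open>\<alpha> i = 1\<close> the floor would be \<open>N\<close>, so the last slab is taken
    with remainder 1.\<close>
  obtain l where l: "l < N" "real l \<le> \<alpha> i * N" "\<alpha> i * N \<le> real l + 1"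
  proof (cases "\<alpha> i * N = N")
    case True
    show ?thesis using True N by (intro that[of "N - 1"]) (auto simp: of_nat_diff)
  next
    case False
    then have lt: "\<alpha> i * N < N" using \<alpha>N by simp
    show ?thesis
    proof (rule that[of "nat \<lfloor>\<alpha> i * N\<rfloor>"])
      show "nat \<lfloor>\<alpha> i * N\<rfloor> < N" using lt N \<alpha>N by (simp add: nat_less_iff floor_less_iff)
      show "real (nat \<lfloor>\<alpha> i * N\<rfloor>) \<le> \<alpha> i * N" using \<alpha>N by simp
      show "\<alpha> i * N \<le> real (nat \<lfloor>\<alpha> i * N\<rfloor>) + 1" using \<alpha>N by (simp; linarith)
    qed
  qed
  define \<beta> where "\<beta> = \<alpha>(i := \<alpha> i * N - l)"
  have "(\<Sum>k\<in>I. \<beta> k *\<^sub>R v k) \<in> parallelepiped I v"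
    using \<alpha>(2,3) l by (intro parallelepipedI) (auto simp: \<beta>_def)
  moreover have "x = real l *\<^sub>R v i + (\<Sum>k\<in>I. \<beta> k *\<^sub>R v k)"
  proof -
    have "(\<Sum>k\<in>I - {i}. \<beta> k *\<^sub>R v k) = (\<Sum>k\<in>I - {i}. \<alpha> k *\<^sub>R v k)"
      by (intro sum.cong) (auto simp: \<beta>_def)
    then have "(\<Sum>k\<in>I. \<beta> k *\<^sub>R v k) = (\<alpha> i * N - l) *\<^sub>R v i + (\<Sum>k\<in>I - {i}. \<alpha> k *\<^sub>R v k)"
      using I by (subst sum.remove[of _ i]) (auto simp: \<beta>_def)
    then show ?thesis
      unfolding \<alpha>(1) sum_scaleR_fun_upd[OF I] by (simp add: algebra_simps)
  qed
  ultimately show "x \<in> (\<Union>l<N. (+) (real l *\<^sub>R v i) ` parallelepiped I v)"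
    using l(1) by blast
qed

text \<open>The last summand is the base case, the empty union. For \<open>\<delta> < 0\<close> no
  cover is admissible and even the empty set has premeasure \<open>\<infinity>\<close>; for
  \<open>\<delta> \<ge> 0\<close> the summand is 0.\<close>

lemma hausdorff_premeasure_translates:
  fixes B :: "'a::real_normed_vector set"
  assumes "A \<subseteq> (\<Union>l<N. (+) (c l) ` B)"
  shows "hausdorff_premeasure \<delta> k A \<le> of_nat N * hausdorff_premeasure \<delta> k B + hausdorff_premeasure \<delta> k ({} :: 'a set)"
proof -
  have "hausdorff_premeasure \<delta> k (\<Union>l<N. (+) (c l) ` B)
      \<le> of_nat N * hausdorff_premeasure \<delta> k B + hausdorff_premeasure \<delta> k ({} :: 'a set)"
  proof (induction N)
    case (Suc N)
    have "hausdorff_premeasure \<delta> k (\<Union>l<Suc N. (+) (c l) ` B)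
        \<le> hausdorff_premeasure \<delta> k ((+) (c N) ` B) + hausdorff_premeasure \<delta> k (\<Union>l<N. (+) (c l) ` B)"
      unfolding lessThan_Suc UN_insert by (rule hausdorff_premeasure_Un)
    also have "\<dots> \<le> hausdorff_premeasure \<delta> k B
        + (of_nat N * hausdorff_premeasure \<delta> k B + hausdorff_premeasure \<delta> k ({} :: 'a set))"
      by (intro add_mono Suc.IH hausdorff_premeasure_translation)
    finally show ?case by (simp add: algebra_simps)
  qed simp
  then show ?thesis
    by (rule order_trans[OF hausdorff_premeasure_mono[OF assms]])
qed

lemma hausdorff_premeasure_single:
  assumes "bounded A" "diameter A \<le> \<delta>" "0 \<le> \<delta>"
  shows "hausdorff_premeasure \<delta> k A \<le> hausdorff_weight k A"
proof -
  define U where "U j = (if j = (0::nat) then A else {})" for j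
  have "hausdorff_premeasure \<delta> k A \<le> (\<Sum>j. hausdorff_weight k (U j))"
    using assms by (intro hausdorff_premeasure_le) (auto simp: U_def split: if_splits)
  also have "\<dots> = (\<Sum>j\<in>{0}. hausdorff_weight k (U j))"
    by (rule suminf_finite) (auto simp: U_def hausdorff_weight_def)
  finally show ?thesis by (simp add: U_def)
qed

text \<open>Edges are stretched one at a time, each at the cost of a factor \<open>N\<close>. A
  general \<open>J\<close> covers the cases of one edge, all edges, and all edges but one.\<close>

lemma hausdorff_premeasure_parallelepiped_multiple:
  fixes v :: "'i \<Rightarrow> 'a::real_normed_vector"
  assumes I: "finite I" and J: "J \<subseteq> I" and N: "N > 0" and \<delta>: "\<delta> \<ge> 0"
  shows "hausdorff_premeasure \<delta> k (parallelepiped I (\<lambda>i. if i \<in> J then real N *\<^sub>R v i else v i))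
       \<le> of_nat (N ^ card J) * hausdorff_premeasure \<delta> k (parallelepiped I v)"
proof -
  have emp: "hausdorff_premeasure \<delta> k ({} :: 'a set) = 0"
    using hausdorff_premeasure_single[of "{} :: 'a set" \<delta> k] \<delta> by (simp add: hausdorff_weight_def)
  have "finite J" using I J finite_subset by blast
  then show ?thesis using J
  proof induction
    case (insert j J)
    define w where "w i = (if i \<in> J then real N *\<^sub>R v i else v i)" for i
    have "(\<lambda>i. if i \<in> insert j J then real N *\<^sub>R v i else v i) = w(j := real N *\<^sub>R w j)"
      using insert.hyps by (auto simp: w_def)
    then have "hausdorff_premeasure \<delta> k (parallelepiped I (\<lambda>i. if i \<in> insert j J then real N *\<^sub>R v i else v i))
        \<le> of_nat N * hausdorff_premeasure \<delta> k (parallelepiped I w)"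
      using hausdorff_premeasure_translates[OF parallelepiped_slabs[OF I _ N, of j w], of \<delta> k] insert.prems
      by (simp add: emp)
    also have "\<dots> \<le> of_nat N * (of_nat (N ^ card J) * hausdorff_premeasure \<delta> k (parallelepiped I v))"
      unfolding w_def using insert.prems by (intro mult_left_mono insert.IH) auto
    finally show ?case using insert.hyps by (simp add: mult.assoc)
  qed simp
qed

lemma hausdorff_measure_parallelepiped_multiple:
  fixes v :: "'i \<Rightarrow> 'a::real_normed_vector"
  assumes "finite I" "J \<subseteq> I" "N > 0"
  shows "hausdorff_measure k (parallelepiped I (\<lambda>i. if i \<in> J then real N *\<^sub>R v i else v i))
       \<le> of_nat (N ^ card J) * hausdorff_measure k (parallelepiped I v)"
  unfolding hausdorff_measure_def[of k "parallelepiped I (\<lambda>i. if i \<in> J then real N *\<^sub>R v i else v i)"]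
proof (rule SUP_least)
  fix \<delta> :: real assume "\<delta> \<in> {0<..}"
  then have \<delta>: "\<delta> > 0" by simp
  show "hausdorff_premeasure \<delta> k (parallelepiped I (\<lambda>i. if i \<in> J then real N *\<^sub>R v i else v i))
      \<le> of_nat (N ^ card J) * hausdorff_measure k (parallelepiped I v)"
    using \<delta> by (intro order_trans[OF hausdorff_premeasure_parallelepiped_multiple[OF assms]]
        mult_left_mono hausdorff_premeasure_le_measure) auto
qed

text \<open>
  Cutting \<open>P(v)\<close> into \<open>N ^ card I\<close> translates of \<open>P(v) / N\<close> does not change the estimate obtained
  from the one-element cover, so that estimate survives the limit \<open>\<delta> \<rightarrow> 0\<close>.
\<close>

lemma hausdorff_measure_parallelepiped_le:
  fixes v :: "'i \<Rightarrow> 'a::real_normed_vector"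
  assumes I: "finite I"
  shows "hausdorff_measure (card I) (parallelepiped I v) \<le> hausdorff_weight (card I) (parallelepiped I v)"
  unfolding hausdorff_measure_def
proof (rule SUP_least)
  fix \<delta> :: real assume "\<delta> \<in> {0<..}"
  then have \<delta>: "\<delta> > 0" by simp
  let ?P = "parallelepiped I v" and ?k = "card I"
  \<comment> \<open>Chosen so that \<open>P(v) / N\<close> has diameter at most
    \<open>\<delta>\<close>; equivalently, \<open>P(v)\<close> is its own admissible cover at mesh
    \<open>N * \<delta>\<close>.\<close>
  obtain N :: nat where "diameter ?P / \<delta> < real N" using reals_Archimedean2 by blast
  then have N: "N > 0" "diameter ?P \<le> real N * \<delta>"
    using \<delta> diameter_ge_0[OF bounded_parallelepiped[of I v]]
    by (auto simp: divide_less_eq intro!: Nat.gr0I)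
  let ?w = "\<lambda>i. (1 / real N) *\<^sub>R v i"
  have "hausdorff_premeasure \<delta> ?k (parallelepiped I ?w)
      = hausdorff_premeasure ((1 / real N) * (real N * \<delta>)) ?k ((*\<^sub>R) (1 / real N) ` ?P)"
    using N by (simp only: parallelepiped_scaleR) simp
  also have "\<dots> \<le> ennreal ((1 / real N) ^ ?k) * hausdorff_premeasure (real N * \<delta>) ?k ?P"
    using N by (intro hausdorff_premeasure_lipschitz) (auto simp: dist_norm simp flip: scaleR_diff_right)
  also have "\<dots> \<le> ennreal ((1 / real N) ^ ?k) * hausdorff_weight ?k ?P"
    using N \<delta> by (intro mult_left_mono hausdorff_premeasure_single bounded_parallelepiped) auto
  finally have w: "hausdorff_premeasure \<delta> ?k (parallelepiped I ?w)
      \<le> ennreal ((1 / real N) ^ ?k) * hausdorff_weight ?k ?P" .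
  have "?P = parallelepiped I (\<lambda>i. if i \<in> I then real N *\<^sub>R ?w i else ?w i)"
    using N by (intro parallelepiped_cong) auto
  then have "hausdorff_premeasure \<delta> ?k ?P
      \<le> of_nat (N ^ ?k) * hausdorff_premeasure \<delta> ?k (parallelepiped I ?w)"
    using hausdorff_premeasure_parallelepiped_multiple[OF I order_refl N(1), of \<delta> ?k ?w] \<delta> by simp
  also have "\<dots> \<le> of_nat (N ^ ?k) * (ennreal ((1 / real N) ^ ?k) * hausdorff_weight ?k ?P)"
    by (rule mult_left_mono[OF w]) simp
  also have "\<dots> = ennreal (real (N ^ ?k) * (1 / real N) ^ ?k) * hausdorff_weight ?k ?P"
    by (simp only: ennreal_mult'' ennreal_of_nat_eq_real_of_nat mult.assoc zero_le_power zero_le_divide_1_iff of_nat_0_le_iff)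
  also have "real (N ^ ?k) * (1 / real N) ^ ?k = 1"
    using N by (simp add: power_divide)
  finally show "hausdorff_premeasure \<delta> ?k ?P \<le> hausdorff_weight ?k ?P" by simp
qed

section \<open>Real-valued volume under scaling and shearing\<close>

definition pvol :: "'i set \<Rightarrow> ('i \<Rightarrow> 'a::real_normed_vector) \<Rightarrow> real" where
  "pvol I v = enn2real (parallelepiped_volume I v)"

lemma pvol_nonneg: "0 \<le> pvol I v"
  by (simp add: pvol_def)

text \<open>\<open>enn2real\<close> sends \<open>\<infinity>\<close> to 0, so finiteness has to be
  known; the one-element cover supplies it.\<close>

lemma ennreal_pvol:
  assumes "finite I"
  shows "ennreal (pvol I v) = hausdorff_measure (card I) (parallelepiped I v)"
proof -
  have "hausdorff_measure (card I) (parallelepiped I v) < top"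
    using hausdorff_measure_parallelepiped_le[OF assms, of v]
    by (rule le_less_trans) (simp add: hausdorff_weight_def)
  then show ?thesis by (simp add: pvol_def parallelepiped_volume_def)
qed

lemma pvol_le:
  assumes "finite I" "finite J" "c \<ge> 0"
    "hausdorff_measure (card I) (parallelepiped I v) \<le> ennreal c * hausdorff_measure (card J) (parallelepiped J w)"
  shows "pvol I v \<le> c * pvol J w"
  using assms by (simp add: ennreal_pvol[symmetric] pvol_nonneg flip: ennreal_mult)

lemma pvol_mono:
  assumes "finite I" "parallelepiped I v \<subseteq> (+) a ` parallelepiped I w"
  shows "pvol I v \<le> pvol I w"
proof -
  have "pvol I v \<le> 1 * pvol I w"
    using order_trans[OF hausdorff_measure_mono[OF assms(2)] hausdorff_measure_translation] assms(1)
    by (intro pvol_le) simp_all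
  then show ?thesis by simp
qed

lemma pvol_cong: "(\<And>i. i \<in> I \<Longrightarrow> v i = w i) \<Longrightarrow> pvol I v = pvol I w"
  unfolding pvol_def parallelepiped_volume_def by (metis parallelepiped_cong)

text \<open>
  Scaling all vectors by \<open>N\<close> multiplies the volume by exactly \<open>N ^ card I\<close>, while scaling a single
  one multiplies it by at most \<open>N\<close>; hence each single scaling is exact.
\<close>

lemma pvol_multiple:
  fixes v :: "'i \<Rightarrow> 'a::real_normed_vector"
  assumes I: "finite I" "i \<in> I" and N: "N > 0"
  shows "pvol I (v(i := real N *\<^sub>R v i)) = real N * pvol I v"
proof (rule antisym)
  have mult: "pvol I (\<lambda>i. if i \<in> J then real N *\<^sub>R w i else w i) \<le> real N ^ card J * pvol I w"
    if "J \<subseteq> I" for J and w :: "'i \<Rightarrow> 'a"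
    using hausdorff_measure_parallelepiped_multiple[OF I(1) that N, of "card I" w] I(1)
    by (intro pvol_le) (simp_all add: ennreal_of_nat_eq_real_of_nat)
  have "(\<lambda>k. if k \<in> {i} then real N *\<^sub>R v k else v k) = v(i := real N *\<^sub>R v i)" by auto
  then show "pvol I (v(i := real N *\<^sub>R v i)) \<le> real N * pvol I v"
    using mult[of "{i}" v] I by simp
  let ?w = "v(i := real N *\<^sub>R v i)" and ?u = "\<lambda>i. real N *\<^sub>R v i"
  have "parallelepiped I v = parallelepiped I (\<lambda>i. (1 / real N) *\<^sub>R ?u i)"
    using N by (intro parallelepiped_cong) auto
  also have "\<dots> = (*\<^sub>R) (1 / real N) ` parallelepiped I ?u"
    by (rule parallelepiped_scaleR)
  finally have "hausdorff_measure (card I) (parallelepiped I v)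
      \<le> ennreal ((1 / real N) ^ card I) * hausdorff_measure (card I) (parallelepiped I ?u)"
    using hausdorff_measure_lipschitz[of "1 / real N" "parallelepiped I ?u" "(*\<^sub>R) (1 / real N)" "card I"] N
    by (simp add: dist_norm flip: scaleR_diff_right)
  then have "pvol I v \<le> (1 / real N) ^ card I * pvol I ?u"
    using I by (intro pvol_le) auto
  then have "real N ^ card I * pvol I v \<le> pvol I ?u"
    using N by (simp add: power_divide field_simps)
  \<comment> \<open>\<open>?u\<close> is \<open>?w\<close> with the other edges stretched as well.
    These account for at most \<open>N ^ (card I - 1)\<close>, which leaves at least a factor
    \<open>N\<close> to the edge \<open>i\<close>.\<close>
  also have "pvol I ?u = pvol I (\<lambda>k. if k \<in> I - {i} then real N *\<^sub>R ?w k else ?w k)"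
    by (rule pvol_cong) auto
  also have "\<dots> \<le> real N ^ card (I - {i}) * pvol I ?w"
    by (rule mult) auto
  finally have "real N ^ card (I - {i}) * (real N * pvol I v) \<le> real N ^ card (I - {i}) * pvol I ?w"
    by (simp only: card.remove[OF I] power_Suc mult_ac)
  moreover have "real N ^ card (I - {i}) > 0" using N by simp
  ultimately show "real N * pvol I v \<le> pvol I ?w"
    by (rule mult_left_le_imp_le)
qed

lemma pvol_scale_mono:
  assumes I: "finite I" "i \<in> I" and ab: "0 \<le> a" "a \<le> b"
  shows "pvol I (v(i := a *\<^sub>R x)) \<le> pvol I (v(i := b *\<^sub>R x))"
proof (rule pvol_mono[OF I(1), of _ 0])
  show "parallelepiped I (v(i := a *\<^sub>R x)) \<subseteq> (+) 0 ` parallelepiped I (v(i := b *\<^sub>R x))"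
  proof
    fix y assume "y \<in> parallelepiped I (v(i := a *\<^sub>R x))"
    then obtain \<alpha> where \<alpha>: "y = (\<Sum>k\<in>I. \<alpha> k *\<^sub>R (v(i := a *\<^sub>R x)) k)"
      "\<And>k. k \<in> I \<Longrightarrow> 0 \<le> \<alpha> k" "\<And>k. k \<in> I \<Longrightarrow> \<alpha> k \<le> 1"
      by (rule parallelepipedE) (rule that; assumption)
    \<comment> \<open>If \<open>b = 0\<close>, then \<open>a = 0\<close> too, and the default
      \<open>x / 0 = 0\<close> still gives an admissible coefficient.\<close>
    define \<beta> where "\<beta> = \<alpha>(i := \<alpha> i * a / b)"
    have "(\<Sum>k\<in>I - {i}. \<alpha> k *\<^sub>R v k) = (\<Sum>k\<in>I - {i}. \<beta> k *\<^sub>R v k)"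
      by (intro sum.cong) (auto simp: \<beta>_def)
    moreover have "\<alpha> i *\<^sub>R a *\<^sub>R x = \<beta> i *\<^sub>R b *\<^sub>R x"
      using ab by (cases "b = 0") (auto simp: \<beta>_def)
    ultimately have "y = (\<Sum>k\<in>I. \<beta> k *\<^sub>R (v(i := b *\<^sub>R x)) k)"
      unfolding \<alpha>(1) sum_scaleR_fun_upd[OF I] by (simp only:)
    moreover have "\<alpha> i * a / b \<le> 1"
      using ab \<alpha>(2,3)[OF I(2)] mult_mono[of "\<alpha> i" 1 a b] by (cases "b = 0") auto
    then have "(\<Sum>k\<in>I. \<beta> k *\<^sub>R (v(i := b *\<^sub>R x)) k) \<in> parallelepiped I (v(i := b *\<^sub>R x))"
      using \<alpha>(2,3) ab I by (intro parallelepipedI) (auto simp: \<beta>_def)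
    ultimately show "y \<in> (+) 0 ` parallelepiped I (v(i := b *\<^sub>R x))" by simp
  qed
qed

text \<open>A monotone real function that is homogeneous under natural factors is linear on the
  nonnegative reals.\<close>

lemma pvol_scale:
  assumes I: "finite I" "i \<in> I" and a: "0 \<le> a"
  shows "pvol I (v(i := a *\<^sub>R x)) = a * pvol I (v(i := x))"
proof -
  define f where "f b = pvol I (v(i := b *\<^sub>R x))" for b
  have f_mult: "f (real N * b) = real N * f b" if "N > 0" for N b
    using pvol_multiple[OF I that, of "v(i := b *\<^sub>R x)"] by (simp add: f_def)
  have f_mono: "f b \<le> f c" if "0 \<le> b" "b \<le> c" for b c
    using pvol_scale_mono[OF I that] by (simp add: f_def)
  have f0: "f 0 = 0" using f_mult[of 2 0] by simp
  have f_nat: "f (real m) = real m * f 1" for m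
    using f_mult[of m 1] f0 by (cases "m = 0") auto
  have f1: "0 \<le> f 1" by (simp add: f_def pvol_nonneg)
  have "\<bar>f a - a * f 1\<bar> \<le> f 1 / real (Suc n)" for n
  proof -
    \<comment> \<open>Since \<open>Suc n * a\<close> lies between \<open>m\<close> and
      \<open>m + 1\<close>, both \<open>Suc n * f a\<close> and \<open>Suc n * a * f 1\<close> lie
      between \<open>m * f 1\<close> and \<open>(m + 1) * f 1\<close>.\<close>
    define m where "m = nat \<lfloor>real (Suc n) * a\<rfloor>"
    have m: "real m \<le> real (Suc n) * a" "real (Suc n) * a \<le> real (Suc m)"
    proof -
      have "real m = of_int \<lfloor>real (Suc n) * a\<rfloor>"
        using a by (simp add: m_def)
      then show "real m \<le> real (Suc n) * a" "real (Suc n) * a \<le> real (Suc m)"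
        using floor_correct[of "real (Suc n) * a"] by linarith+
    qed
    have "real m * f 1 \<le> real (Suc n) * f a" "real (Suc n) * f a \<le> real (Suc m) * f 1"
      using f_mono[OF _ m(1)] f_mono[OF _ m(2)] a f_mult[of "Suc n" a] f_nat[of m] f_nat[of "Suc m"]
      by auto
    moreover have "real m * f 1 \<le> real (Suc n) * a * f 1" "real (Suc n) * a * f 1 \<le> real (Suc m) * f 1"
      using m f1 by (intro mult_right_mono; simp)+
    moreover have "real (Suc m) * f 1 = real m * f 1 + f 1" by (simp add: algebra_simps)
    ultimately have "\<bar>real (Suc n) * f a - real (Suc n) * a * f 1\<bar> \<le> f 1" by linarith
    then have "real (Suc n) * \<bar>f a - a * f 1\<bar> \<le> f 1"
      by (simp only: mult.assoc abs_mult abs_of_nat flip: right_diff_distrib)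
    then show ?thesis by (simp only: pos_le_divide_eq of_nat_0_less_iff zero_less_Suc mult.commute)
  qed
  moreover have "(\<lambda>n. f 1 / real (Suc n)) \<longlonglongrightarrow> 0"
    by (rule LIMSEQ_Suc[OF lim_const_over_n])
  ultimately have "\<bar>f a - a * f 1\<bar> \<le> 0"
    by (intro tendsto_lowerbound[of _ 0 sequentially]) auto
  then show ?thesis by (simp add: f_def)
qed

text \<open>
  A slab of height \<open>1 / N\<close> of the sheared parallelepiped fits into an unsheared slab whose \<open>i\<close>-th
  edge is stretched by \<open>1 + \<bar>t\<bar> / N\<close>.
\<close>

lemma pvol_shear_le:
  assumes I: "finite I" "i \<in> I" "j \<in> I" and ij: "i \<noteq> j"
  shows "pvol I (v(j := v j + t *\<^sub>R v i)) \<le> pvol I v"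
proof -
  have le: "pvol I (v(j := v j + t *\<^sub>R v i)) \<le> (1 + \<bar>t\<bar> / real (Suc n)) * pvol I v" for n
  proof -
    define h where "h = 1 / real (Suc n)"
    have h: "h > 0" by (simp add: h_def)
    define w where "w = v(j := h *\<^sub>R v j)"
    let ?u = "v(j := h *\<^sub>R (v j + t *\<^sub>R v i))" and ?u' = "w(i := (1 + \<bar>t\<bar> * h) *\<^sub>R w i)"
    have "parallelepiped I ?u \<subseteq> (+) (min 0 (t * h) *\<^sub>R v i) ` parallelepiped I ?u'"
    proof
      fix y assume "y \<in> parallelepiped I ?u"
      then obtain \<alpha> where \<alpha>: "y = (\<Sum>k\<in>I. \<alpha> k *\<^sub>R ?u k)"
        "\<And>k. k \<in> I \<Longrightarrow> 0 \<le> \<alpha> k" "\<And>k. k \<in> I \<Longrightarrow> \<alpha> k \<le> 1"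
        by (rule parallelepipedE) (rule that; assumption)
      \<comment> \<open>The \<open>v i\<close>-coordinate of \<open>y\<close>, shifted to start at 0
        for either sign of \<open>t\<close>: the shear adds to \<open>\<alpha> i\<close> a number
        between 0 and \<open>t * h\<close>, so an edge of length factor
        \<open>1 + \<bar>t\<bar> * h\<close> holds it.\<close>
      define \<gamma> where "\<gamma> = \<alpha> i + \<alpha> j * (t * h) - min 0 (t * h)"
      define s where "s = 1 + \<bar>t\<bar> * h"
      have s: "s > 0" using h by (simp add: s_def add_pos_nonneg)
      have th: "\<bar>t\<bar> * h = \<bar>t * h\<bar>" using h by (simp add: abs_mult)
      have "0 \<le> \<gamma> \<and> \<gamma> \<le> s"
      proof (cases "t * h \<ge> 0")
        case True
        then show ?thesis
          using \<alpha>(2,3)[OF I(2)] \<alpha>(2,3)[OF I(3)] mult_left_le_one_le[of "t * h" "\<alpha> j"]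
          unfolding \<gamma>_def s_def th by auto
      next
        case False
        then have "\<alpha> j * (t * h) \<ge> t * h" "\<alpha> j * (t * h) \<le> 0"
          using \<alpha>(2,3)[OF I(3)] mult_right_mono_neg[of "\<alpha> j" 1 "t * h"]
          by (simp_all add: mult_nonneg_nonpos)
        then show ?thesis
          using False \<alpha>(2,3)[OF I(2)] unfolding \<gamma>_def s_def th by auto
      qed
      define \<beta> where "\<beta> = \<alpha>(i := \<gamma> / s)"
      have \<beta>: "(\<Sum>k\<in>I. \<beta> k *\<^sub>R ?u' k) \<in> parallelepiped I ?u'"
        using \<alpha>(2,3) s \<open>0 \<le> \<gamma> \<and> \<gamma> \<le> s\<close> by (intro parallelepipedI) (auto simp: \<beta>_def)
      have split: "(\<Sum>k\<in>I. g k) = g i + (g j + (\<Sum>k\<in>I - {i} - {j}. g k))" for g :: "'a \<Rightarrow> 'b"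
        using I ij by (simp add: sum.remove[of I i] sum.remove[of "I - {i}" j])
      have "(\<Sum>k\<in>I - {i} - {j}. \<alpha> k *\<^sub>R ?u k) = (\<Sum>k\<in>I - {i} - {j}. \<beta> k *\<^sub>R ?u' k)"
        by (intro sum.cong) (auto simp: \<beta>_def w_def)
      moreover have "\<alpha> i *\<^sub>R ?u i + \<alpha> j *\<^sub>R ?u j
          = min 0 (t * h) *\<^sub>R v i + (\<beta> i *\<^sub>R ?u' i + \<beta> j *\<^sub>R ?u' j)"
      proof -
        have "\<beta> i *\<^sub>R ?u' i = \<gamma> *\<^sub>R v i"
          using ij s by (simp add: \<beta>_def w_def flip: s_def)
        then show ?thesis
          using ij by (simp add: \<beta>_def w_def \<gamma>_def scaleR_add_left scaleR_add_right scaleR_diff_left mult.commute mult.left_commute)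
      qed
      ultimately have "y = min 0 (t * h) *\<^sub>R v i + (\<Sum>k\<in>I. \<beta> k *\<^sub>R ?u' k)"
        unfolding \<alpha>(1) split by (simp only: add.assoc[symmetric])
      then show "y \<in> (+) (min 0 (t * h) *\<^sub>R v i) ` parallelepiped I ?u'"
        using \<beta> by blast
    qed
    then have "pvol I ?u \<le> pvol I ?u'" by (rule pvol_mono[OF I(1)])
    also have "pvol I ?u = h * pvol I (v(j := v j + t *\<^sub>R v i))"
      using h I by (intro pvol_scale) auto
    also have "pvol I ?u' = (1 + \<bar>t\<bar> * h) * pvol I w"
      using pvol_scale[OF I(1,2), of "1 + \<bar>t\<bar> * h" w "w i"] h by (simp add: fun_upd_idem)
    also have "pvol I w = h * pvol I v"
      unfolding w_def using pvol_scale[OF I(1,3), of h v "v j"] h by (simp add: fun_upd_idem)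
    finally have "h * pvol I (v(j := v j + t *\<^sub>R v i)) \<le> h * ((1 + \<bar>t\<bar> * h) * pvol I v)"
      by (simp only: mult_ac)
    then have "pvol I (v(j := v j + t *\<^sub>R v i)) \<le> (1 + \<bar>t\<bar> * h) * pvol I v"
      by (simp only: mult_le_cancel_left_pos[OF h])
    then show ?thesis by (simp add: h_def)
  qed
  have "(\<lambda>n. (1 + \<bar>t\<bar> / real (Suc n)) * pvol I v) \<longlonglongrightarrow> (1 + 0) * pvol I v"
    by (intro tendsto_mult tendsto_add tendsto_const LIMSEQ_Suc[OF lim_const_over_n])
  then show ?thesis
    using le by (intro tendsto_lowerbound[of _ _ sequentially]) auto
qed

lemma pvol_shear:
  assumes I: "finite I" "i \<in> I" "j \<in> I" and ij: "i \<noteq> j"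
  shows "pvol I (v(j := v j + t *\<^sub>R v i)) = pvol I v"
proof (rule antisym)
  let ?w = "v(j := v j + t *\<^sub>R v i)"
  have "?w(j := ?w j + (- t) *\<^sub>R ?w i) = v" using ij by auto
  then show "pvol I v \<le> pvol I ?w"
    using pvol_shear_le[OF assms, of ?w "- t"] by simp
qed (rule pvol_shear_le[OF assms])

subsection \<open>Principal minors\<close>

text \<open>Indexing the Leibniz determinant by a set keeps all principal minors of one matrix
  within one type; the empty minor is 1.\<close>

definition principal_minor :: "'i set \<Rightarrow> ('i \<Rightarrow> 'i \<Rightarrow> real) \<Rightarrow> real" where
  "principal_minor I A = (\<Sum>p | p permutes I. of_int (sign p) * (\<Prod>i\<in>I. A i (p i)))"

lemma principal_minor_cong:
  assumes "\<And>i j. i \<in> I \<Longrightarrow> j \<in> I \<Longrightarrow> A i j = B i j"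
  shows "principal_minor I A = principal_minor I B"
  unfolding principal_minor_def
  using assms by (intro sum.cong arg_cong2[where f = "(*)"] prod.cong) (auto simp: permutes_in_image)

lemma principal_minor_transpose:
  assumes "finite I"
  shows "principal_minor I (\<lambda>i j. A j i) = principal_minor I A"
proof -
  have "of_int (sign (inv p)) * (\<Prod>i\<in>I. A (inv p i) i) = of_int (sign p) * (\<Prod>i\<in>I. A i (p i))"
    if p: "p permutes I" for p
  proof -
    have "(\<Prod>i\<in>I. A (inv p i) i) = (\<Prod>i\<in>I. A (inv p (p i)) (p i))"
      by (rule prod.permute[OF p, unfolded o_def])
    then show ?thesis
      using p assms by (simp add: permutes_inverses sign_inverse permutes_imp_permutation)
  qed
  moreover have "principal_minor I (\<lambda>i j. A j i)
      = (\<Sum>p | p permutes I. of_int (sign (inv p)) * (\<Prod>i\<in>I. A (inv p i) i))"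
    unfolding principal_minor_def by (rule sum.reindex_bij_witness[of _ inv inv])
      (auto simp: permutes_inv permutes_inv_inv)
  ultimately show ?thesis by (simp add: principal_minor_def)
qed

lemma principal_minor_row_linear:
  assumes "finite I" "j \<in> I"
  shows "principal_minor I (A(j := \<lambda>k. x k + t * y k))
       = principal_minor I (A(j := x)) + t * principal_minor I (A(j := y))"
proof -
  have "(\<Prod>i\<in>I. (A(j := z)) i (p i)) = z (p j) * (\<Prod>i\<in>I - {j}. A i (p i))" for z p
    using assms by (subst prod.remove[of _ j]) auto
  then show ?thesis
    unfolding principal_minor_def sum_distrib_left sum.distrib[symmetric]
    by (intro sum.cong) (auto simp: algebra_simps)
qed

text \<open>Composing with the transposition of the two rows reverses the sign of a permutation but
  keeps its product, so the Leibniz sum is its own negative.\<close>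

lemma principal_minor_identical_rows:
  assumes "finite I" "i \<in> I" "j \<in> I" "i \<noteq> j" "\<And>k. k \<in> I \<Longrightarrow> A i k = A j k"
  shows "principal_minor I A = 0"
proof -
  let ?t = "Transposition.transpose i j" and ?f = "\<lambda>p. of_int (sign p) * (\<Prod>i\<in>I. A i (p i))"
  have t: "?t permutes I" using assms by (simp add: permutes_swap_id)
  have A: "A (?t k) m = A k m" if "m \<in> I" for k m
    using assms(5)[OF that] by (auto simp: Transposition.transpose_def)
  have "?f (p \<circ> ?t) = - ?f p" if p: "p permutes I" for p
  proof -
    have "(\<Prod>k\<in>I. A k (p k)) = (\<Prod>k\<in>I. A (?t k) (p (?t k)))"
      by (rule prod.permute[OF t, unfolded o_def])
    also have "\<dots> = (\<Prod>k\<in>I. A k (p (?t k)))"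
      using p t by (intro prod.cong refl A) (simp add: permutes_in_image)
    moreover have "sign (p \<circ> ?t) = - sign p"
      using p t assms by (subst sign_compose) (auto simp: permutes_imp_permutation sign_swap_id)
    ultimately show ?thesis by simp
  qed
  then have "principal_minor I A = - (\<Sum>p | p permutes I. ?f (p \<circ> ?t))"
    by (simp add: principal_minor_def sum_negf)
  also have "(\<Sum>p | p permutes I. ?f (p \<circ> ?t)) = principal_minor I A"
    unfolding principal_minor_def using t
    by (intro sum.reindex_bij_witness[of _ "\<lambda>p. p \<circ> ?t" "\<lambda>p. p \<circ> ?t"])
      (auto simp: permutes_compose comp_assoc)
  finally show ?thesis by simp
qed

lemma principal_minor_identity:
  assumes "finite I"
  shows "principal_minor I (\<lambda>i j. if i = j then 1 else 0) = 1"
proof -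
  have "(\<Prod>i\<in>I. if i = p i then 1 else 0 :: real) = 0" if p: "p permutes I" "p \<noteq> id" for p
  proof -
    obtain i where "p i \<noteq> i" using p(2) by (auto simp: fun_eq_iff)
    then have "i \<in> I" using p(1) permutes_not_in by metis
    then show ?thesis using \<open>p i \<noteq> i\<close> assms by (intro prod_zero) (auto intro!: bexI[of _ i])
  qed
  then have "principal_minor I (\<lambda>i j. if i = j then 1 else 0)
      = (\<Sum>p | p permutes I. if p = id then 1 else 0)"
    unfolding principal_minor_def by (intro sum.cong) (auto simp: sign_id)
  also have "\<dots> = 1"
    using assms by (simp add: finite_permutations permutes_id)
  finally show ?thesis .
qed

subsection \<open>Gram determinants\<close>

text \<open>Two families make the determinant linear in each vector of the first one, whereas
  changing a vector of a single family alters a row and a column at once. Facts on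
  \<open>gram\<close> follow by changing one side, transposing, and changing the other.\<close>

definition cross_gram :: "'i set \<Rightarrow> ('i \<Rightarrow> 'a::real_inner) \<Rightarrow> ('i \<Rightarrow> 'a) \<Rightarrow> real" where
  "cross_gram I v w = principal_minor I (\<lambda>i j. v i \<bullet> w j)"

abbreviation gram :: "'i set \<Rightarrow> ('i \<Rightarrow> 'a::real_inner) \<Rightarrow> real" where
  "gram I v \<equiv> cross_gram I v v"

lemma cross_gram_commute: "finite I \<Longrightarrow> cross_gram I v w = cross_gram I w v"
  unfolding cross_gram_def
  by (subst principal_minor_transpose[symmetric]) (auto simp: inner_commute)

lemma cross_gram_linear:
  assumes "finite I" "j \<in> I"
  shows "cross_gram I (v(j := x + t *\<^sub>R y)) w = cross_gram I (v(j := x)) w + t * cross_gram I (v(j := y)) w"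
proof -
  have *: "(\<lambda>i k. (v(j := z)) i \<bullet> w k) = (\<lambda>i k. v i \<bullet> w k)(j := \<lambda>k. z \<bullet> w k)" for z
    by (auto simp: fun_eq_iff)
  show ?thesis
    unfolding cross_gram_def * inner_add_left inner_scaleR_left
    by (rule principal_minor_row_linear[OF assms])
qed

lemma cross_gram_shear:
  assumes "finite I" "i \<in> I" "j \<in> I" "i \<noteq> j"
  shows "cross_gram I (v(j := v j + t *\<^sub>R v i)) w = cross_gram I v w"
proof -
  have "cross_gram I (v(j := v i)) w = 0"
    unfolding cross_gram_def using assms by (intro principal_minor_identical_rows[of _ i j]) auto
  then show ?thesis using assms by (simp add: cross_gram_linear)
qed

lemma cross_gram_scale:
  assumes "finite I" "j \<in> I"
  shows "cross_gram I (v(j := t *\<^sub>R x)) w = t * cross_gram I (v(j := x)) w"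
  \<comment> \<open>The instances with a zero summand force the determinant with a zero row to
    vanish.\<close>
  using cross_gram_linear[OF assms, of v 0 "t - 1" 0 w] cross_gram_linear[OF assms, of v 0 t x w]
    cross_gram_linear[OF assms, of v 0 1 0 w] by simp

lemma gram_shear:
  assumes "finite I" "i \<in> I" "j \<in> I" "i \<noteq> j"
  shows "gram I (v(j := v j + t *\<^sub>R v i)) = gram I v"
  using cross_gram_shear[OF assms, of v t "v(j := v j + t *\<^sub>R v i)"] cross_gram_shear[OF assms, of v t v]
    cross_gram_commute[OF assms(1), of v "v(j := v j + t *\<^sub>R v i)"]
  by argo

lemma gram_scale:
  assumes "finite I" "j \<in> I"
  shows "gram I (v(j := t *\<^sub>R x)) = t\<^sup>2 * gram I (v(j := x))"
proof -
  have "gram I (v(j := t *\<^sub>R x)) = t * cross_gram I (v(j := x)) (v(j := t *\<^sub>R x))"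
    by (rule cross_gram_scale[OF assms])
  also have "cross_gram I (v(j := x)) (v(j := t *\<^sub>R x)) = cross_gram I (v(j := t *\<^sub>R x)) (v(j := x))"
    by (rule cross_gram_commute[OF assms(1)])
  also have "\<dots> = t * gram I (v(j := x))"
    by (rule cross_gram_scale[OF assms])
  finally show ?thesis by (simp only: power2_eq_square mult.assoc)
qed

lemma gram_orthonormal:
  assumes "finite I" "\<And>i j. i \<in> I \<Longrightarrow> j \<in> I \<Longrightarrow> u i \<bullet> u j = (if i = j then 1 else 0)"
  shows "gram I u = 1"
  unfolding cross_gram_def
  using principal_minor_identity[OF assms(1)] assms(2)
  by (subst principal_minor_cong[where B = "\<lambda>i j. if i = j then 1 else 0"]) auto

subsection \<open>Volume and Gram determinant\<close>

text \<open>\<open>F\<close> is abstract because both \<open>pvol\<close> and \<open>gram\<close>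
  are inserted. As \<open>K\<close> avoids \<open>j\<close>, the vectors to be added stay unchanged
  throughout.\<close>

lemma sum_shear_invariant:
  fixes v :: "'i \<Rightarrow> 'a::real_vector"
  assumes shear: "\<And>v i t. i \<in> I \<Longrightarrow> i \<noteq> j \<Longrightarrow> F (v(j := v j + t *\<^sub>R v i)) = F v"
    and K: "finite K" "K \<subseteq> I - {j}"
  shows "F (v(j := v j + (\<Sum>k\<in>K. t k *\<^sub>R v k))) = F v"
  using K
proof induction
  case (insert k K)
  let ?w = "v(j := v j + (\<Sum>k\<in>K. t k *\<^sub>R v k))"
  have "F (v(j := v j + (\<Sum>k\<in>insert k K. t k *\<^sub>R v k))) = F (?w(j := ?w j + t k *\<^sub>R ?w k))"
    using insert by (intro arg_cong[of _ _ F]) (auto simp: algebra_simps)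
  also have "\<dots> = F ?w" using insert by (intro shear) auto
  also have "F ?w = F v" using insert by (intro insert.IH) auto
  finally show ?case .
qed simp

text \<open>One Gram-Schmidt run serves both quantities: shears fix them, and normalising a residual
  of length \<open>r\<close> extracts \<open>r\<close> from the volume and the square of
  \<open>r\<close> from the Gram determinant. \<open>\<rho>\<close> collects these lengths and is 0
  once a residual vanishes.\<close>

lemma gram_schmidt_reduction:
  fixes v :: "'i \<Rightarrow> 'a::real_inner"
  assumes I: "finite I"
  obtains u :: "'i \<Rightarrow> 'a" and \<rho> where "0 \<le> \<rho>" "pvol I v = \<rho> * pvol I u" "gram I v = \<rho>\<^sup>2 * gram I u"
    "\<rho> = 0 \<or> (\<forall>i\<in>I. \<forall>j\<in>I. u i \<bullet> u j = (if i = j then 1 else 0))"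
proof -
  have "\<exists>(u :: 'i \<Rightarrow> 'a) \<rho>. 0 \<le> \<rho> \<and> pvol I v = \<rho> * pvol I u \<and> gram I v = \<rho>\<^sup>2 * gram I u \<and>
      (\<rho> = 0 \<or> (\<forall>i\<in>J. \<forall>j\<in>J. u i \<bullet> u j = (if i = j then 1 else 0)))"
    if "J \<subseteq> I" for J
    using finite_subset[OF that I] that
  proof (induction J)
    case empty
    show ?case by (intro exI[of _ v] exI[of _ 1]) simp
  next
    case (insert j J)
    then obtain u :: "'i \<Rightarrow> 'a" and \<rho> where u: "0 \<le> \<rho>" "pvol I v = \<rho> * pvol I u" "gram I v = \<rho>\<^sup>2 * gram I u"
      "\<rho> = 0 \<or> (\<forall>i\<in>J. \<forall>j\<in>J. u i \<bullet> u j = (if i = j then 1 else 0))"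
      by auto
    show ?case
    proof (cases "\<rho> = 0")
      case True
      then show ?thesis using u by (intro exI[of _ u] exI[of _ 0]) simp
    next
      case False
      then have orth: "u i \<bullet> u k = (if i = k then 1 else 0)" if "i \<in> J" "k \<in> J" for i k
        using u(4) that by blast
      have j: "j \<in> I" "J \<subseteq> I - {j}" using insert by auto
      define x where "x = u j + (\<Sum>k\<in>J. (- (u j \<bullet> u k)) *\<^sub>R u k)"
      have vol: "pvol I (u(j := x)) = pvol I u"
        unfolding x_def using insert.hyps j
        by (intro sum_shear_invariant[where I = I] pvol_shear I) auto
      have det: "gram I (u(j := x)) = gram I u"
        unfolding x_def using insert.hyps j
        by (intro sum_shear_invariant[where I = I and F = "gram I"] gram_shear I) auto
      have x_orth: "x \<bullet> u i = 0" if i: "i \<in> J" for i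
      proof -
        have "x \<bullet> u i = u j \<bullet> u i + (\<Sum>k\<in>J. - (u j \<bullet> u k) * (u k \<bullet> u i))"
          by (simp add: x_def inner_add_left inner_sum_left)
        also have "(\<Sum>k\<in>J. - (u j \<bullet> u k) * (u k \<bullet> u i)) = (\<Sum>k\<in>J. if k = i then - (u j \<bullet> u i) else 0)"
          using orth i by (intro sum.cong) auto
        finally show ?thesis using i insert.hyps by simp
      qed
      define r where "r = norm x"
      define w where "w = u(j := (1 / r) *\<^sub>R x)"
      \<comment> \<open>This includes \<open>x = 0\<close>, where \<open>1 / r = 0\<close>; then
        \<open>\<rho> * r = 0\<close>, and the first alternative of the claim applies.\<close>
      have xr: "r *\<^sub>R ((1 / r) *\<^sub>R x) = x" by (simp add: r_def)
      have r0: "0 \<le> r" by (simp add: r_def)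
      have "pvol I (u(j := x)) = r * pvol I w" "gram I (u(j := x)) = r\<^sup>2 * gram I w"
        using pvol_scale[OF I j(1) r0, of u "(1 / r) *\<^sub>R x"] gram_scale[OF I j(1), of u r "(1 / r) *\<^sub>R x"]
        unfolding xr w_def by simp_all
      then have w: "pvol I v = (\<rho> * r) * pvol I w" "gram I v = (\<rho> * r)\<^sup>2 * gram I w"
        using u(2,3) vol det by (simp_all add: power_mult_distrib)
      have wj: "w j = (1 / r) *\<^sub>R x" by (simp add: w_def)
      have wJ: "w i = u i" if "i \<in> J" for i using that insert.hyps(2) by (auto simp: w_def)
      have w_orth: "w i \<bullet> w k = (if i = k then 1 else 0)"
        if ik: "r \<noteq> 0" "i \<in> insert j J" "k \<in> insert j J" for i k
      proof -
        have jj: "w j \<bullet> w j = 1"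
          using ik(1) by (simp add: wj r_def dot_square_norm power2_eq_square)
        have jJ: "w j \<bullet> u l = 0" "u l \<bullet> w j = 0" if "l \<in> J" for l
          using x_orth[OF that] inner_commute[of "u l" x] by (simp_all add: wj)
        have neq: "j \<noteq> l" "l \<noteq> j" if "l \<in> J" for l using that insert.hyps(2) by auto
        consider "i = j" "k = j" | "i = j" "k \<in> J" | "i \<in> J" "k = j" | "i \<in> J" "k \<in> J"
          using ik(2,3) by blast
        then show ?thesis by cases (simp_all add: jj jJ neq wJ orth)
      qed
      have "\<rho> * r = 0 \<or> (\<forall>i\<in>insert j J. \<forall>k\<in>insert j J. w i \<bullet> w k = (if i = k then 1 else 0))"
        using w_orth by (cases "r = 0") (simp, blast)
      then show ?thesis
        using w mult_nonneg_nonneg[OF u(1) r0] by blast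
    qed
  qed
  then show ?thesis using that by blast
qed

section \<open>Positive volume of orthonormal cubes\<close>

lemma compact_parallelepiped:
  fixes v :: "'i \<Rightarrow> 'a::real_normed_vector"
  assumes "finite I"
  shows "compact (parallelepiped I v)"
  using assms
proof induction
  case empty
  have "parallelepiped {} v = {0}" by (auto simp: parallelepiped_def)
  then show ?case by simp
next
  case (insert i I)
  let ?f = "\<lambda>(t, y). t *\<^sub>R v i + y"
  have "parallelepiped (insert i I) v \<subseteq> ?f ` ({0..1} \<times> parallelepiped I v)"
  proof
    fix x assume "x \<in> parallelepiped (insert i I) v"
    then obtain \<alpha> where \<alpha>: "x = (\<Sum>k\<in>insert i I. \<alpha> k *\<^sub>R v k)"
      "\<And>k. k \<in> insert i I \<Longrightarrow> 0 \<le> \<alpha> k" "\<And>k. k \<in> insert i I \<Longrightarrow> \<alpha> k \<le> 1"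
      by (rule parallelepipedE) (rule that; assumption)
    have "(\<Sum>k\<in>I. \<alpha> k *\<^sub>R v k) \<in> parallelepiped I v"
      using \<alpha>(2,3) by (intro parallelepipedI) simp_all
    moreover have "x = ?f (\<alpha> i, \<Sum>k\<in>I. \<alpha> k *\<^sub>R v k)"
      using insert.hyps by (simp add: \<alpha>(1))
    ultimately show "x \<in> ?f ` ({0..1} \<times> parallelepiped I v)"
      using \<alpha>(2,3)[of i] by (intro image_eqI[of x ?f "(\<alpha> i, \<Sum>k\<in>I. \<alpha> k *\<^sub>R v k)"]) simp_all
  qed
  moreover have "?f ` ({0..1} \<times> parallelepiped I v) \<subseteq> parallelepiped (insert i I) v"
  proof
    fix x assume "x \<in> ?f ` ({0..1} \<times> parallelepiped I v)"
    then obtain t y where ty: "x = t *\<^sub>R v i + y" "0 \<le> t" "t \<le> 1" "y \<in> parallelepiped I v" by auto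
    obtain \<alpha> where \<alpha>: "y = (\<Sum>k\<in>I. \<alpha> k *\<^sub>R v k)" "\<And>k. k \<in> I \<Longrightarrow> 0 \<le> \<alpha> k" "\<And>k. k \<in> I \<Longrightarrow> \<alpha> k \<le> 1"
      using ty(4) by (rule parallelepipedE) (rule that; assumption)
    define \<beta> where "\<beta> = \<alpha>(i := t)"
    have "(\<Sum>k\<in>I. \<beta> k *\<^sub>R v k) = y"
      unfolding \<alpha>(1) using insert.hyps by (intro sum.cong) (auto simp: \<beta>_def)
    then have "x = (\<Sum>k\<in>insert i I. \<beta> k *\<^sub>R v k)"
      using insert.hyps by (simp add: ty(1)) (simp add: \<beta>_def)
    also have "\<dots> \<in> parallelepiped (insert i I) v"
      using \<alpha>(2,3) ty(2,3) by (intro parallelepipedI) (auto simp: \<beta>_def)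
    finally show "x \<in> parallelepiped (insert i I) v" .
  qed
  ultimately have "parallelepiped (insert i I) v = ?f ` ({0..1} \<times> parallelepiped I v)" by blast
  moreover have "continuous_on ({0..1} \<times> parallelepiped I v) ?f"
    unfolding case_prod_unfold by (intro continuous_intros)
  ultimately show ?case
    using insert.IH by (simp add: compact_continuous_image compact_Times)
qed

text \<open>
  A set of diameter at most \<open>d\<close> contains at most \<open>(N * d + 1) ^ card I\<close> points of the grid of mesh
  \<open>1 / N\<close> in a unit cube.
\<close>

lemma unit_cube_cover_sum_ge_1:
  fixes u :: "'i \<Rightarrow> 'a::real_inner"
  assumes I: "finite I" and orth: "\<And>i j. i \<in> I \<Longrightarrow> j \<in> I \<Longrightarrow> u i \<bullet> u j = (if i = j then 1 else 0)"
    and F: "finite F" and cover: "parallelepiped I u \<subseteq> (\<Union>j\<in>F. V j)"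
    and d0: "\<And>j. j \<in> F \<Longrightarrow> 0 \<le> d j"
    and d: "\<And>j x y. j \<in> F \<Longrightarrow> x \<in> V j \<Longrightarrow> y \<in> V j \<Longrightarrow> dist x y \<le> d j"
  shows "1 \<le> (\<Sum>j\<in>F. d j ^ card I)"
proof -
  have step: "1 \<le> (\<Sum>j\<in>F. (d j + 1 / real (Suc n)) ^ card I)" for n
  proof -
    define N where "N = Suc n"
    have N: "0 < real N" by (simp add: N_def)
    define G where "G = (\<Pi>\<^sub>E i\<in>I. {..<N})"
    define p where "p f = (\<Sum>i\<in>I. (real (f i) / real N) *\<^sub>R u i)" for f
    define H where "H j = {f \<in> G. p f \<in> V j}" for j
    have G_fin: "finite G" and G_card: "card G = N ^ card I"
      using I by (simp_all add: G_def finite_PiE card_PiE)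
    have p_coord: "p f \<bullet> u i = real (f i) / real N" if i: "i \<in> I" for f i
    proof -
      have "p f \<bullet> u i = (\<Sum>l\<in>I. if l = i then real (f i) / real N else 0)"
        unfolding p_def inner_sum_left using orth i by (intro sum.cong) auto
      then show ?thesis using i I by simp
    qed
    have "G \<subseteq> (\<Union>j\<in>F. H j)"
    proof
      fix f assume f: "f \<in> G"
      then have "real (f i) \<le> real N" if "i \<in> I" for i
        using that by (auto simp: G_def PiE_iff less_imp_le)
      then have "p f \<in> parallelepiped I u"
        unfolding p_def using N by (intro parallelepipedI) simp_all
      then show "f \<in> (\<Union>j\<in>F. H j)" using f cover by (auto simp: H_def)
    qed
    then have "card G \<le> card (\<Union>j\<in>F. H j)"
      using G_fin F by (intro card_mono finite_UN_I) (simp_all add: H_def)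
    also have "\<dots> \<le> (\<Sum>j\<in>F. card (H j))"
      using F by (rule card_UN_le)
    finally have "real (card G) \<le> (\<Sum>j\<in>F. real (card (H j)))"
      by (simp flip: of_nat_sum)
    also have "\<dots> \<le> (\<Sum>j\<in>F. (real N * d j + 1) ^ card I)"
    proof (rule sum_mono)
      fix j assume j: "j \<in> F"
      have nonneg: "0 \<le> real N * d j" using d0[OF j] by simp
      define m where "m = nat \<lfloor>real N * d j\<rfloor>"
      \<comment> \<open>The inner product with the unit vector \<open>u i\<close> bounds each
        coordinate difference by the distance. Grid coordinates are integers over \<open>N\<close>,
        so the bound may be rounded down to \<open>m\<close>.\<close>
      have close: "f i \<le> g i + m" if "f \<in> H j" "g \<in> H j" "i \<in> I" for f g i
      proof -
        have "(real (f i) - real (g i)) / real N = (p f - p g) \<bullet> u i"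
          using that(3) by (simp add: inner_diff_left p_coord diff_divide_distrib)
        also have "\<dots> \<le> norm (p f - p g) * norm (u i)"
          by (rule norm_cauchy_schwarz)
        also have "norm (u i) = 1" using orth[OF that(3) that(3)] by (simp add: norm_eq_1)
        also have "norm (p f - p g) * 1 \<le> d j"
          using d[OF j, of "p f" "p g"] that(1,2) by (simp add: H_def dist_norm)
        finally have "real (f i) - real (g i) \<le> real N * d j"
          using N by (simp add: pos_divide_le_eq mult.commute)
        then have "int (f i) - int (g i) \<le> \<lfloor>real N * d j\<rfloor>"
          by (simp add: le_floor_iff)
        then show ?thesis by (simp add: m_def)
      qed
      have "card (H j) \<le> (m + 1) ^ card I"
      proof (cases "H j = {}")
        case False
        \<comment> \<open>Counting from the smallest \<open>i\<close>-th coordinate,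
          \<open>close\<close> leaves only \<open>m + 1\<close> values.\<close>
        define a where "a i = Min ((\<lambda>f. f i) ` H j)" for i
        have H_fin: "finite (H j)" using G_fin by (simp add: H_def)
        have "H j \<subseteq> (\<Pi>\<^sub>E i\<in>I. {a i..a i + m})"
        proof
          fix f assume f: "f \<in> H j"
          have "a i \<le> f i \<and> f i \<le> a i + m" if "i \<in> I" for i
          proof
            show "a i \<le> f i" unfolding a_def using f H_fin by simp
            have "a i \<in> (\<lambda>f. f i) ` H j"
              unfolding a_def using H_fin False by (intro Min_in) simp_all
            then show "f i \<le> a i + m" using close[OF f _ that] by auto
          qed
          then show "f \<in> (\<Pi>\<^sub>E i\<in>I. {a i..a i + m})"
            using f by (auto simp: H_def G_def PiE_iff)
        qed
        then have "card (H j) \<le> card (\<Pi>\<^sub>E i\<in>I. {a i..a i + m})"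
          using I by (intro card_mono finite_PiE) simp_all
        then show ?thesis using I by (simp add: card_PiE)
      qed simp
      then have "real (card (H j)) \<le> (real m + 1) ^ card I"
        by (metis of_nat_1 of_nat_add of_nat_mono of_nat_power)
      also have "\<dots> \<le> (real N * d j + 1) ^ card I"
        using nonneg by (intro power_mono) (simp_all add: m_def)
      finally show "real (card (H j)) \<le> (real N * d j + 1) ^ card I" .
    qed
    also have "\<dots> = real N ^ card I * (\<Sum>j\<in>F. (d j + 1 / real N) ^ card I)"
      unfolding sum_distrib_left power_mult_distrib[symmetric]
      using N by (intro sum.cong refl arg_cong[where f = "\<lambda>x. x ^ card I"]) (simp add: distrib_left)
    finally have "real N ^ card I * 1 \<le> real N ^ card I * (\<Sum>j\<in>F. (d j + 1 / real N) ^ card I)"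
      by (simp add: G_card)
    then show ?thesis
      unfolding N_def by (rule mult_left_le_imp_le) simp
  qed
  \<comment> \<open>The rounding error \<open>1 / N\<close> of each piece disappears in the limit
    because \<open>F\<close> is finite.\<close>
  have "(\<lambda>n. \<Sum>j\<in>F. (d j + 1 / real (Suc n)) ^ card I) \<longlonglongrightarrow> (\<Sum>j\<in>F. (d j + 0) ^ card I)"
    by (intro tendsto_sum tendsto_power tendsto_add tendsto_const LIMSEQ_Suc[OF lim_const_over_n])
  then have "1 \<le> (\<Sum>j\<in>F. (d j + 0) ^ card I)"
    by (rule tendsto_lowerbound[OF _ always_eventually[OF allI[OF step]]]) simp
  then show ?thesis by simp
qed

text \<open>Every cover weighs at least \<open>C / 2\<close>: its pieces are slightly enlarged to
  open sets, compactness leaves finitely many, and the grid count applies. A bound at mesh 1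
  suffices, since each premeasure is below the measure.\<close>

lemma pvol_orthonormal_pos:
  fixes u :: "'i \<Rightarrow> 'a::real_inner"
  assumes I: "finite I" and orth: "\<And>i j. i \<in> I \<Longrightarrow> j \<in> I \<Longrightarrow> u i \<bullet> u j = (if i = j then 1 else 0)"
  shows "pvol I u > 0"
proof -
  define k where "k = card I"
  define C where "C = unit_ball_vol (real k) / 2 ^ k"
  have C: "C > 0" by (simp add: C_def)
  have "ennreal (C / 2) \<le> hausdorff_premeasure 1 k (parallelepiped I u)"
  proof (rule hausdorff_premeasure_greatest)
    fix U :: "nat \<Rightarrow> 'a set"
    assume U: "parallelepiped I u \<subseteq> (\<Union>j. U j)" "\<And>j. bounded (U j)" "\<And>j. diameter (U j) \<le> 1"
    define D where "D j = diameter (U j)" for j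
    have D: "0 \<le> D j" for j unfolding D_def by (rule diameter_ge_0[OF U(2)])
    \<comment> \<open>The enlargement radii are chosen so that the total excess of the
      \<open>k\<close>-th powers is at most \<open>1 / 2\<close>, half of what the grid count
      guarantees.\<close>
    have "\<exists>e. 0 < e \<and> (D j + 2 * e) ^ k < D j ^ k + (1 / 2) ^ Suc j / 2" for j
    proof -
      have "((\<lambda>e. (D j + 2 * e) ^ k) \<longlongrightarrow> (D j + 2 * 0) ^ k) (at_right 0)"
        by (intro tendsto_intros)
      then have "\<forall>\<^sub>F e in at_right 0. (D j + 2 * e) ^ k < D j ^ k + (1 / 2) ^ Suc j / 2"
        by (rule order_tendstoD(2)) simp
      moreover have "\<forall>\<^sub>F e in at_right 0. (0::real) < e"
        by (rule eventually_at_right_less)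
      ultimately have "\<forall>\<^sub>F e in at_right 0. 0 < e \<and> (D j + 2 * e) ^ k < D j ^ k + (1 / 2) ^ Suc j / 2"
        by eventually_elim simp
      then show ?thesis
        by (rule eventually_happens'[OF trivial_limit_at_right_real])
    qed
    then have "\<exists>e. \<forall>j. 0 < e j \<and> (D j + 2 * e j) ^ k < D j ^ k + (1 / 2) ^ Suc j / 2"
      by (intro choice allI)
    then obtain e where e: "\<And>j. 0 < e j" "\<And>j. (D j + 2 * e j) ^ k < D j ^ k + (1 / 2) ^ Suc j / 2"
      by blast
    define V where "V j = (\<Union>y\<in>U j. ball y (e j))" for j
    have V_dist: "dist x y \<le> D j + 2 * e j" if xy: "x \<in> V j" "y \<in> V j" for x y j
    proof -
      obtain a b where ab: "a \<in> U j" "b \<in> U j" "dist a x < e j" "dist b y < e j"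
        using xy by (auto simp: V_def)
      have "dist x y \<le> dist x a + (dist a b + dist b y)"
        by (meson add_left_mono dist_triangle order_trans)
      also have "dist a b \<le> D j"
        unfolding D_def using ab U(2) by (intro diameter_bounded_bound)
      finally show ?thesis using ab(3,4) by (simp add: dist_commute)
    qed
    have UV: "U j \<subseteq> V j" for j using e(1)[of j] by (auto simp: V_def)
    have V_open: "open (V j)" for j by (simp add: V_def open_UN)
    \<comment> \<open>Empty pieces are discarded: they weigh 0, while \<open>C * D j ^ k\<close>
      would be \<open>C\<close> for \<open>k = 0\<close>.\<close>
    have V_cover: "parallelepiped I u \<subseteq> (\<Union>j\<in>{j. U j \<noteq> {}}. V j)"
    proof
      fix x assume "x \<in> parallelepiped I u"
      then obtain j where "x \<in> U j" using U(1) by (meson UN_iff subsetD)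
      then show "x \<in> (\<Union>j\<in>{j. U j \<noteq> {}}. V j)" using UV[of j] by blast
    qed
    obtain F where F: "F \<subseteq> {j. U j \<noteq> {}}" "finite F" "parallelepiped I u \<subseteq> (\<Union>j\<in>F. V j)"
      by (rule compactE_image[OF compact_parallelepiped[OF I] V_open V_cover])
    have "1 \<le> (\<Sum>j\<in>F. (D j + 2 * e j) ^ k)"
      unfolding k_def
    proof (rule unit_cube_cover_sum_ge_1[OF I orth F(2,3)])
      show "0 \<le> D j + 2 * e j" for j using D[of j] e(1)[of j] by simp
    qed (assumption | rule V_dist)+
    also have "\<dots> \<le> (\<Sum>j\<in>F. D j ^ k + (1 / 2) ^ Suc j / 2)"
      by (intro sum_mono less_imp_le e(2))
    also have "\<dots> = (\<Sum>j\<in>F. D j ^ k) + (\<Sum>j\<in>F. (1 / 2) ^ Suc j) / 2"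
      by (simp only: sum.distrib sum_divide_distrib)
    finally have "1 \<le> (\<Sum>j\<in>F. D j ^ k) + (\<Sum>j\<in>F. (1 / 2) ^ Suc j) / 2" .
    moreover have "(\<Sum>j\<in>F. (1 / 2) ^ Suc j) \<le> (1 :: real)"
      using power_half_series sum_le_suminf[of "\<lambda>j. (1 / 2 :: real) ^ Suc j" F] F(2)
      by (simp only: sums_iff) simp
    ultimately have half: "1 / 2 \<le> (\<Sum>j\<in>F. D j ^ k)" by linarith
    have "C / 2 \<le> (\<Sum>j\<in>F. C * D j ^ k)"
      using mult_left_mono[OF half, of C] C by (simp add: sum_distrib_left)
    then have "ennreal (C / 2) \<le> ennreal (\<Sum>j\<in>F. C * D j ^ k)"
      by (rule ennreal_leI)
    also have "\<dots> = (\<Sum>j\<in>F. ennreal (C * D j ^ k))"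
      using C D by (intro sum_ennreal[symmetric]) simp
    also have "\<dots> = (\<Sum>j\<in>F. hausdorff_weight k (U j))"
      using F(1) by (intro sum.cong) (auto simp: hausdorff_weight_def C_def D_def power_divide)
    also have "\<dots> \<le> (\<Sum>j. hausdorff_weight k (U j))"
      using F(2) by (intro sum_le_suminf) simp_all
    finally show "ennreal (C / 2) \<le> (\<Sum>j. hausdorff_weight k (U j))" .
  qed
  also have "\<dots> \<le> ennreal (pvol I u)"
    unfolding ennreal_pvol[OF I] k_def by (rule hausdorff_premeasure_le_measure) simp
  finally have "C / 2 \<le> pvol I u"
    by (simp only: ennreal_le_iff[OF pvol_nonneg])
  then show ?thesis using C by simp
qed

section \<open>Isometries from Gram matrices, and equality of Gram determinants\<close>

lemma inner_sum_scaleR: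
  "(\<Sum>i\<in>I. a i *\<^sub>R v i) \<bullet> (\<Sum>j\<in>J. b j *\<^sub>R w j) = (\<Sum>i\<in>I. \<Sum>j\<in>J. a i * (b j * (v i \<bullet> w j)))"
  by (subst inner_sum_left) (simp add: inner_sum_right sum_distrib_left mult.left_commute)

text \<open>
  Replacing \<open>v i\<close> by \<open>- v i\<close> translates the parallelepiped by \<open>- v i\<close>; in coordinates this is the
  reflection of the \<open>i\<close>-th coordinate.
\<close>

lemma isometric_parallelepiped:
  fixes v :: "'i \<Rightarrow> 'a::real_inner" and w :: "'i \<Rightarrow> 'b::real_inner"
  assumes \<epsilon>: "\<And>i. i \<in> I \<Longrightarrow> \<epsilon> i \<in> {1, -1}"
    and vw: "\<And>i j. i \<in> I \<Longrightarrow> j \<in> I \<Longrightarrow> w i \<bullet> w j = \<epsilon> i * \<epsilon> j * (v i \<bullet> v j)"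
  shows "isometric (parallelepiped I v) (parallelepiped I w)"
proof -
  define flip where "flip \<alpha> i = (if \<epsilon> i = 1 then \<alpha> i else 1 - \<alpha> i)" for \<alpha> :: "'i \<Rightarrow> real" and i
  define X where "X \<alpha> = (\<Sum>i\<in>I. \<alpha> i *\<^sub>R v i)" for \<alpha>
  define Y where "Y \<alpha> = (\<Sum>i\<in>I. flip \<alpha> i *\<^sub>R w i)" for \<alpha>
  define unit where "unit \<alpha> \<longleftrightarrow> (\<forall>i\<in>I. 0 \<le> \<alpha> i \<and> \<alpha> i \<le> (1::real))" for \<alpha>
  have dist_eq: "dist (Y \<alpha>) (Y \<beta>) = dist (X \<alpha>) (X \<beta>)" for \<alpha> \<beta>
  proof -
    \<comment> \<open>A reflected coordinate has slope -1, so coefficient differences pick up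
      \<open>\<epsilon> i\<close>, which cancels the signs in \<open>vw\<close>.\<close>
    have "flip \<alpha> i - flip \<beta> i = \<epsilon> i * (\<alpha> i - \<beta> i)" if "i \<in> I" for i
      using \<epsilon>[OF that] by (auto simp: flip_def)
    then have Yd: "Y \<alpha> - Y \<beta> = (\<Sum>i\<in>I. (\<epsilon> i * (\<alpha> i - \<beta> i)) *\<^sub>R w i)"
      by (simp add: Y_def sum_subtractf[symmetric] scaleR_diff_left[symmetric])
    have Xd: "X \<alpha> - X \<beta> = (\<Sum>i\<in>I. (\<alpha> i - \<beta> i) *\<^sub>R v i)"
      by (simp add: X_def sum_subtractf scaleR_diff_left)
    have \<epsilon>2: "\<epsilon> i * \<epsilon> i = 1" if "i \<in> I" for i using \<epsilon>[OF that] by auto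
    have "(\<epsilon> i * (\<alpha> i - \<beta> i)) * ((\<epsilon> j * (\<alpha> j - \<beta> j)) * (w i \<bullet> w j))
        = (\<alpha> i - \<beta> i) * ((\<alpha> j - \<beta> j) * (v i \<bullet> v j))" if "i \<in> I" "j \<in> I" for i j
    proof -
      have "(\<epsilon> i * (\<alpha> i - \<beta> i)) * ((\<epsilon> j * (\<alpha> j - \<beta> j)) * (w i \<bullet> w j))
          = (\<epsilon> i * \<epsilon> i) * (\<epsilon> j * \<epsilon> j) * ((\<alpha> i - \<beta> i) * ((\<alpha> j - \<beta> j) * (v i \<bullet> v j)))"
        unfolding vw[OF that] by (simp only: mult_ac)
      then show ?thesis using \<epsilon>2 that by simp
    qed
    then have "(Y \<alpha> - Y \<beta>) \<bullet> (Y \<alpha> - Y \<beta>) = (X \<alpha> - X \<beta>) \<bullet> (X \<alpha> - X \<beta>)"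
      unfolding Xd Yd inner_sum_scaleR by (intro sum.cong refl)
    then show ?thesis by (simp add: dist_norm norm_eq_sqrt_inner)
  qed
  have XP: "parallelepiped I v = {X \<alpha> | \<alpha>. unit \<alpha>}"
    by (simp add: parallelepiped_def X_def unit_def)
  have unit_flip: "unit (flip \<alpha>)" if "unit \<alpha>" for \<alpha>
    using that by (auto simp: unit_def flip_def)
  have flip_flip: "flip (flip \<alpha>) = \<alpha>" for \<alpha>
    by (auto simp: flip_def)
  have YP: "parallelepiped I w = {Y \<alpha> | \<alpha>. unit \<alpha>}"
  proof -
    have "parallelepiped I w = {(\<Sum>i\<in>I. \<alpha> i *\<^sub>R w i) | \<alpha>. unit \<alpha>}"
      by (simp add: parallelepiped_def unit_def)
    also have "\<dots> = {Y \<alpha> | \<alpha>. unit \<alpha>}"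
    proof (intro Collect_cong iffI; elim exE conjE)
      fix y \<alpha> assume "y = (\<Sum>i\<in>I. \<alpha> i *\<^sub>R w i)" "unit \<alpha>"
      then show "\<exists>\<alpha>. y = Y \<alpha> \<and> unit \<alpha>"
        using unit_flip by (intro exI[of _ "flip \<alpha>"]) (simp add: Y_def flip_flip)
    next
      fix y \<alpha> assume "y = Y \<alpha>" "unit \<alpha>"
      then show "\<exists>\<alpha>. y = (\<Sum>i\<in>I. \<alpha> i *\<^sub>R w i) \<and> unit \<alpha>"
        using unit_flip by (intro exI[of _ "flip \<alpha>"]) (simp add: Y_def)
    qed
    finally show ?thesis .
  qed
  \<comment> \<open>Independent of the chosen coefficients: by \<open>dist_eq\<close>, equal values
    of \<open>X\<close> force equal values of \<open>Y\<close>.\<close>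
  define f where "f x = Y (SOME \<alpha>. unit \<alpha> \<and> X \<alpha> = x)" for x
  have f: "f (X \<alpha>) = Y \<alpha>" if "unit \<alpha>" for \<alpha>
  proof -
    have "unit (SOME \<beta>. unit \<beta> \<and> X \<beta> = X \<alpha>) \<and> X (SOME \<beta>. unit \<beta> \<and> X \<beta> = X \<alpha>) = X \<alpha>"
      by (rule someI[of _ \<alpha>]) (use that in simp)
    then have "dist (f (X \<alpha>)) (Y \<alpha>) = 0" unfolding f_def dist_eq by simp
    then show ?thesis by simp
  qed
  have f_dist: "dist (f x) (f y) = dist x y" if "x \<in> parallelepiped I v" "y \<in> parallelepiped I v" for x y
    using that f dist_eq unfolding XP by auto
  moreover have "inj_on f (parallelepiped I v)"
    by (rule inj_onI) (metis f_dist dist_eq_0_iff)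
  moreover have "f ` parallelepiped I v = parallelepiped I w"
    unfolding XP YP using f by force
  ultimately show ?thesis
    unfolding isometric_def bij_betw_def by blast
qed

lemma pvol_orthonormal_eq:
  fixes u :: "'i \<Rightarrow> 'a::real_inner" and w :: "'i \<Rightarrow> 'b::real_inner"
  assumes I: "finite I"
    and u: "\<And>i j. i \<in> I \<Longrightarrow> j \<in> I \<Longrightarrow> u i \<bullet> u j = (if i = j then 1 else 0)"
    and w: "\<And>i j. i \<in> I \<Longrightarrow> j \<in> I \<Longrightarrow> w i \<bullet> w j = (if i = j then 1 else 0)"
  shows "pvol I u = pvol I w"
proof -
  have "isometric (parallelepiped I u) (parallelepiped I w)" "isometric (parallelepiped I w) (parallelepiped I u)"
    using u w by (auto intro!: isometric_parallelepiped[of I "\<lambda>_. 1"])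
  then show ?thesis
    unfolding pvol_def parallelepiped_volume_def
    using isometric_hausdorff_measure_le by (metis antisym)
qed

text \<open>The volumes are \<open>c * \<rho>\<close> and \<open>c * \<mu>\<close> with the same
  \<open>c > 0\<close> unless a factor is 0, and the Gram determinants are the squares of the
  factors. If one factor is 0, equality of the volumes makes the other 0.\<close>

lemma gram_eq_if_pvol_eq:
  fixes v w :: "'i \<Rightarrow> 'a::real_inner"
  assumes I: "finite I" and vw: "pvol I v = pvol I w"
  shows "gram I v = gram I w"
proof -
  obtain u :: "'i \<Rightarrow> 'a" and \<rho> where u: "0 \<le> \<rho>" "pvol I v = \<rho> * pvol I u" "gram I v = \<rho>\<^sup>2 * gram I u"
    "\<rho> = 0 \<or> (\<forall>i\<in>I. \<forall>j\<in>I. u i \<bullet> u j = (if i = j then 1 else 0))"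
    by (rule gram_schmidt_reduction[OF I])
  obtain u' :: "'i \<Rightarrow> 'a" and \<mu> where u': "0 \<le> \<mu>" "pvol I w = \<mu> * pvol I u'" "gram I w = \<mu>\<^sup>2 * gram I u'"
    "\<mu> = 0 \<or> (\<forall>i\<in>I. \<forall>j\<in>I. u' i \<bullet> u' j = (if i = j then 1 else 0))"
    by (rule gram_schmidt_reduction[OF I])
  have pos: "\<rho> \<noteq> 0 \<Longrightarrow> pvol I u > 0" "\<mu> \<noteq> 0 \<Longrightarrow> pvol I u' > 0"
    using u(4) u'(4) by (auto intro: pvol_orthonormal_pos[OF I])
  show ?thesis
  proof (cases "\<rho> = 0 \<or> \<mu> = 0")
    case True
    then have "\<rho> = 0 \<and> \<mu> = 0"
      using pos u(2) u'(2) vw by (metis mult_eq_0_iff less_irrefl)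
    then show ?thesis using u(3) u'(3) by simp
  next
    case False
    then have "pvol I u = pvol I u'" "gram I u = 1" "gram I u' = 1"
      using u(4) u'(4) by (auto intro!: pvol_orthonormal_eq[OF I] gram_orthonormal[OF I])
    moreover have "\<rho> = \<mu>" using calculation(1) pos False u(2) u'(2) vw by auto
    ultimately show ?thesis using u(3) u'(3) by simp
  qed
qed

subsection \<open>Symmetric matrices with equal principal minors\<close>

text \<open>In each Leibniz product every index occurs once as a row and once as a column, so every
  sign is squared.\<close>

lemma principal_minor_switch:
  assumes "finite I" "\<And>i. i \<in> I \<Longrightarrow> \<epsilon> i \<in> {1, -1}"
  shows "principal_minor I (\<lambda>i j. \<epsilon> i * \<epsilon> j * A i j) = principal_minor I A"
proof -
  have "(\<Prod>i\<in>I. \<epsilon> i * \<epsilon> (p i) * A i (p i)) = (\<Prod>i\<in>I. A i (p i))" if p: "p permutes I" for p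
  proof -
    have "(\<Prod>i\<in>I. \<epsilon> (p i)) = (\<Prod>i\<in>I. \<epsilon> i)"
      using prod.permute[OF p, of \<epsilon>] by (simp add: o_def)
    moreover have "(\<Prod>i\<in>I. \<epsilon> i) * (\<Prod>i\<in>I. \<epsilon> i) = (\<Prod>i\<in>I. 1)"
      unfolding prod.distrib[symmetric] using assms(2) by (intro prod.cong refl) fastforce
    ultimately show ?thesis by (simp add: prod.distrib)
  qed
  then show ?thesis unfolding principal_minor_def by simp
qed

lemma principal_minor_singleton: "principal_minor {i} A = A i i"
proof -
  have "{p. p permutes {i}} = {id}" by auto
  then show ?thesis by (simp add: principal_minor_def sign_id)
qed

lemma principal_minor_doubleton:
  assumes "i \<noteq> j"
  shows "principal_minor {i, j} A = A i i * A j j - A i j * A j i"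
proof -
  have "{p. p permutes {i, j}} = {id, Transposition.transpose i j}" by (auto simp: permutes_doubleton_iff)
  moreover have "id \<noteq> Transposition.transpose i j"
    using assms by (metis id_apply transpose_apply_first)
  ultimately show ?thesis
    using assms by (simp add: principal_minor_def sign_id sign_swap_id)
qed

text \<open>
  In the Leibniz formula of a symmetric matrix supported on a chordless cycle \<open>i, x 0, \<dots>, x m\<close>,
  flipping the sign of the edge \<open>i, x 0\<close> only affects the two cyclic permutations, and these
  contribute equal nonzero terms.
\<close>

lemma principal_minor_chordless_cycle:
  fixes x :: "nat \<Rightarrow> 'i" and i :: 'i and m :: nat and A B :: "'i \<Rightarrow> 'i \<Rightarrow> real"
  defines "J \<equiv> insert i (x ` {..m})"
  assumes m: "m > 0" and inj: "inj_on x {..m}" and i: "i \<notin> x ` {..m}"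
    and sym: "\<And>y z. A y z = A z y"
    and chord: "\<And>k l. Suc k < l \<Longrightarrow> l \<le> m \<Longrightarrow> A (x k) (x l) = 0"
    and path: "\<And>k. k < m \<Longrightarrow> A (x k) (x (Suc k)) \<noteq> 0"
    and ends: "A i (x 0) \<noteq> 0" "A i (x m) \<noteq> 0"
    and inner: "\<And>k. 0 < k \<Longrightarrow> k < m \<Longrightarrow> A i (x k) = 0"
    and B: "\<And>y z. y \<in> J \<Longrightarrow> z \<in> J \<Longrightarrow> B y z = (if {y, z} = {i, x 0} then - A y z else A y z)"
  shows "principal_minor J A \<noteq> principal_minor J B"
proof -
  have finJ: "finite J" by (simp add: J_def)
  have xJ: "x k \<in> J" if "k \<le> m" for k using that by (simp add: J_def)
  have iJ: "i \<in> J" by (simp add: J_def)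
  have xi: "x k \<noteq> i" if "k \<le> m" for k using i that by auto
  have xx: "x k = x l \<longleftrightarrow> k = l" if "k \<le> m" "l \<le> m" for k l
    using inj that by (auto simp: inj_on_def)
  \<comment> \<open>The cyclic permutation that sends \<open>i\<close> to \<open>x 0\<close>, each
    \<open>x k\<close> to \<open>x (Suc k)\<close>, and \<open>x m\<close> back to
    \<open>i\<close>.\<close>
  define c where "c y = (if y = i then x 0 else if y = x m then i
      else if y \<in> x ` {..m} then x (Suc (inv_into {..m} x y)) else y)" for y
  have c: "c i = x 0" "c (x m) = i" "\<And>k. k < m \<Longrightarrow> c (x k) = x (Suc k)"
    "\<And>y. y \<notin> J \<Longrightarrow> c y = y"
    using xi xx m inj by (auto simp: c_def J_def inv_into_f_f)
  have c_perm: "c permutes J"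
  proof (rule bij_imp_permutes)
    have "c ` J \<subseteq> J"
    proof
      fix y assume "y \<in> c ` J"
      then consider "y = c i" | k where "k \<le> m" "y = c (x k)" by (auto simp: J_def)
      then show "y \<in> J"
      proof cases
        case 2
        then show ?thesis using c xJ iJ by (cases "k = m") auto
      qed (use c xJ in simp)
    qed
    moreover have "J \<subseteq> c ` J"
    proof
      fix y assume "y \<in> J"
      then consider "y = i" | "y = x 0" | k where "k < m" "y = x (Suc k)"
        unfolding J_def by (auto simp: less_Suc_eq_le) (metis Suc_le_lessD not0_implies_Suc)
      then show "y \<in> c ` J"
        using c(1-3) xJ iJ by cases (metis imageI order_refl less_imp_le)+
    qed
    ultimately show "bij_betw c J J"
      using finite_surj_inj[OF finJ] by (auto simp: bij_betw_def)
  qed (use c in auto)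
  let ?t = "\<lambda>A p. of_int (sign p) * (\<Prod>y\<in>J. A y (p y)) :: real"
  \<comment> \<open>Permutations using the flipped edge in one direction only; in both directions
    the two sign changes cancel.\<close>
  define S where "S = {p. p permutes J \<and> p i = x 0 \<and> p (x 0) \<noteq> i}"
  define S' where "S' = {p. p permutes J \<and> p i \<noteq> x 0 \<and> p (x 0) = i}"
  have fin: "finite {p. p permutes J}" using finJ by (rule finite_permutations)
  have tB: "?t B p = (if p \<in> S \<or> p \<in> S' then - ?t A p else ?t A p)" if p: "p permutes J" for p
  proof -
    have split: "(\<Prod>y\<in>J. g y) = g i * (g (x 0) * (\<Prod>y\<in>J - {i} - {x 0}. g y))" for g :: "'i \<Rightarrow> real"
      using iJ xJ[of 0] xi[of 0] finJ by (simp add: prod.remove[of J i] prod.remove[of "J - {i}" "x 0"])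
    have Bp: "B y (p y) = (if {y, p y} = {i, x 0} then - A y (p y) else A y (p y))" if "y \<in> J" for y
      using B[OF that, of "p y"] p that by (simp add: permutes_in_image)
    have "(\<Prod>y\<in>J - {i} - {x 0}. B y (p y)) = (\<Prod>y\<in>J - {i} - {x 0}. A y (p y))"
      using Bp by (intro prod.cong) (auto simp: doubleton_eq_iff)
    moreover have "B i (p i) = (if p i = x 0 then - A i (p i) else A i (p i))"
      using Bp[OF iJ] xi[of 0] by (auto simp: doubleton_eq_iff)
    moreover have "B (x 0) (p (x 0)) = (if p (x 0) = i then - A (x 0) (p (x 0)) else A (x 0) (p (x 0)))"
      using Bp[OF xJ[of 0]] xi[of 0] by (auto simp: doubleton_eq_iff)
    ultimately show ?thesis
      using p unfolding split by (auto simp: S_def S'_def)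
  qed
  have S_unique: "p = c" if p: "p \<in> S" and nz: "\<And>y. y \<in> J \<Longrightarrow> A y (p y) \<noteq> 0" for p
  proof -
    have pp: "p permutes J" "p i = x 0" "p (x 0) \<noteq> i" using p by (auto simp: S_def)
    have pinj: "p y = p z \<longleftrightarrow> y = z" for y z using pp(1) by (metis permutes_inj injD)
    \<comment> \<open>From \<open>x k\<close> a nonzero term cannot jump ahead (no chords), cannot
      return to \<open>i\<close> (zero entries, or \<open>p \<in> S\<close> for
      \<open>k = 0\<close>), and cannot hit \<open>x l\<close> with \<open>l \<le> k\<close>, which
      already has a preimage.\<close>
    have step: "p (x k) = x (Suc k)" if "k < m" for k
      using that
    proof (induction k rule: less_induct)
      case (less k)
      have "p (x k) \<in> J" using pp(1) xJ less.prems by (simp add: permutes_in_image)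
      moreover have "p (x k) \<noteq> i"
        using nz[OF xJ[of k]] pp(3) inner[of k] sym[of i "x k"] less.prems by (cases "k = 0") auto
      ultimately obtain l where l: "l \<le> m" "p (x k) = x l" by (auto simp: J_def)
      have "\<not> Suc k < l" using nz[OF xJ[of k]] chord[of k l] l less.prems by auto
      moreover have "\<not> l \<le> k"
      proof
        assume lk: "l \<le> k"
        show False
        proof (cases l)
          case 0
          then show False using pp(2) l pinj[of "x k" i] xi[of k] less.prems by simp
        next
          case (Suc l')
          then have "p (x l') = x l" using less lk by simp
          then show False using l lk Suc pinj[of "x k" "x l'"] xx[of k l'] less.prems by simp
        qed
      qed
      ultimately have "l = Suc k" by linarith
      then show ?case using l by simp
    qed
    have "p (x m) = i"
    proof (rule ccontr)
      assume "p (x m) \<noteq> i"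
      moreover have "p (x m) \<in> J" using pp(1) xJ by (simp add: permutes_in_image)
      ultimately obtain l where l: "l \<le> m" "p (x m) = x l" by (auto simp: J_def)
      show False
      proof (cases l)
        case 0
        then show False using pp(2) l pinj[of "x m" i] xi[of m] by simp
      next
        case (Suc l')
        then show False using l step[of l'] pinj[of "x m" "x l'"] xx[of m l'] by simp
      qed
    qed
    then have "p (x k) = c (x k)" if "k \<le> m" for k
      using that step c by (cases "k = m") auto
    then have "p y = c y" if "y \<in> J" for y
      using that pp(2) c(1) by (auto simp: J_def)
    then have "p y = c y" for y
      using c(4) permutes_not_in[OF pp(1)] by (cases "y \<in> J") simp_all
    then show ?thesis by auto
  qed
  have "c \<in> S"
    using c_perm c m xi[of 1] by (simp add: S_def)
  have nzc: "A y (c y) \<noteq> 0" if yJ: "y \<in> J" for y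
  proof -
    consider "y = i" | "y = x m" | k where "k < m" "y = x k"
      using yJ unfolding J_def by (auto simp: le_less)
    then show ?thesis using c ends path sym[of "x m" i] by cases auto
  qed
  have "(\<Sum>p\<in>S. ?t A p) = (\<Sum>p\<in>{c}. ?t A p)"
  proof (rule sum.mono_neutral_right)
    show "finite S" using fin by (rule finite_subset[rotated]) (auto simp: S_def)
    show "{c} \<subseteq> S" using \<open>c \<in> S\<close> by simp
    show "\<forall>p\<in>S - {c}. ?t A p = 0"
    proof
      fix p assume "p \<in> S - {c}"
      then obtain y where "y \<in> J" "A y (p y) = 0" using S_unique by blast
      then show "?t A p = 0" using finJ by (simp add: prod_zero_iff) blast
    qed
  qed
  moreover have "?t A c \<noteq> 0"
    using nzc finJ by (simp add: prod_zero_iff sign_def)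
  ultimately have nz: "(\<Sum>p\<in>S. ?t A p) \<noteq> 0" by simp
  \<comment> \<open>By symmetry, reversing the orientation preserves each term; inversion exchanges
    \<open>S\<close> and \<open>S'\<close>.\<close>
  have t_inv: "?t A (inv p) = ?t A p" if p: "p permutes J" for p
  proof -
    have "(\<Prod>y\<in>J. A y (inv p y)) = (\<Prod>y\<in>J. A (p y) (inv p (p y)))"
      by (rule prod.permute[OF p, unfolded o_def])
    also have "\<dots> = (\<Prod>y\<in>J. A y (p y))"
      using p by (simp add: permutes_inverses sym)
    finally show ?thesis
      using p finJ by (simp add: sign_inverse permutes_imp_permutation)
  qed
  have inv_iff: "inv p y = z \<longleftrightarrow> p z = y" if "p permutes J" for p y z
    using that by (metis permutes_inverses)
  have SS': "(\<Sum>p\<in>S'. ?t A p) = (\<Sum>p\<in>S. ?t A p)"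
    by (rule sum.reindex_bij_witness[of _ inv inv])
      (auto simp: S_def S'_def permutes_inv permutes_inv_inv t_inv inv_iff)
  have "principal_minor J A - principal_minor J B = (\<Sum>p | p permutes J. ?t A p - ?t B p)"
    by (simp add: principal_minor_def sum_subtractf)
  also have "\<dots> = (\<Sum>p | p permutes J. if p \<in> S \<union> S' then 2 * ?t A p else 0)"
    using tB by (intro sum.cong) auto
  also have "\<dots> = (\<Sum>p\<in>S \<union> S'. 2 * ?t A p)"
    using fin by (intro sum.mono_neutral_cong_right) (auto simp: S_def S'_def)
  also have "\<dots> = (\<Sum>p\<in>S. 2 * ?t A p) + (\<Sum>p\<in>S'. 2 * ?t A p)"
    using fin by (intro sum.union_disjoint) (auto simp: S_def S'_def elim: finite_subset[rotated])
  \<comment> \<open>One factor 2 comes from the change of sign, the other from the two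
    orientations.\<close>
  also have "\<dots> = 4 * (\<Sum>p\<in>S. ?t A p)"
    unfolding sum_distrib_left[symmetric] SS' by simp
  finally show ?thesis using nz by auto
qed

text \<open>Induction on the index set. Once signs are fixed on \<open>K\<close>, only the signs in
  the new row \<open>i\<close> can be wrong. Negating \<open>\<epsilon>\<close> on the components of
  \<open>K\<close> that contain a wrong neighbour repairs them, provided that no such component also
  contains a right one.\<close>

lemma equal_principal_minors_imp_switching:
  fixes A B :: "'i \<Rightarrow> 'i \<Rightarrow> real"
  assumes "finite I"
    and symA: "\<And>y z. A y z = A z y" and symB: "\<And>y z. B y z = B z y"
    and "\<And>J. J \<subseteq> I \<Longrightarrow> J \<noteq> {} \<Longrightarrow> principal_minor J A = principal_minor J B"
  obtains \<epsilon> where "\<And>i. \<epsilon> i \<in> {1, -1}" "\<And>i j. i \<in> I \<Longrightarrow> j \<in> I \<Longrightarrow> B i j = \<epsilon> i * \<epsilon> j * A i j"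
proof -
  have "\<exists>\<epsilon>. (\<forall>i. \<epsilon> i \<in> {1, -1}) \<and> (\<forall>i\<in>I. \<forall>j\<in>I. B i j = \<epsilon> i * \<epsilon> j * A i j)"
    using assms(1,4)
  proof (induction I)
    case empty
    show ?case by (rule exI[of _ "\<lambda>_. 1"]) simp
  next
    case (insert i K)
    then obtain \<epsilon> where \<epsilon>: "\<And>i. \<epsilon> i \<in> {1, -1 :: real}"
      and \<epsilon>K: "\<And>y z. y \<in> K \<Longrightarrow> z \<in> K \<Longrightarrow> B y z = \<epsilon> y * \<epsilon> z * A y z"
      by (metis (no_types, lifting) subset_insertI2)
    define A' where "A' y z = \<epsilon> y * \<epsilon> z * A y z" for y z
    have symA': "A' y z = A' z y" for y z using symA[of y z] by (simp add: A'_def)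
    have A'K: "B y z = A' y z" if "y \<in> K" "z \<in> K" for y z
      using \<epsilon>K[OF that] by (simp add: A'_def)
    have minors: "principal_minor J A' = principal_minor J B" if "J \<subseteq> insert i K" "J \<noteq> {}" for J
      using principal_minor_switch[of J \<epsilon> A] \<epsilon> insert.prems[OF that] finite_subset[OF that(1)] insert.hyps
      by (simp add: A'_def[abs_def])
    have diag: "B y y = A' y y" if "y \<in> insert i K" for y
      using minors[of "{y}"] that by (simp add: principal_minor_singleton)
    have abs_eq: "B i y = A' i y \<or> B i y = - A' i y" if "y \<in> K" for y
    proof -
      have "i \<noteq> y" using that insert.hyps by auto
      then have "(B i y)\<^sup>2 = (A' i y)\<^sup>2"
        using minors[of "{i, y}"] that diag[of i] diag[of y] symB[of y i] symA'[of y i]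
        by (simp add: principal_minor_doubleton power2_eq_square)
      then show ?thesis by (simp add: power2_eq_iff)
    qed
    define M where "M = {y \<in> K. A' i y \<noteq> 0 \<and> B i y = - A' i y}"
    define E where "E = {(y, z). y \<in> K \<and> z \<in> K \<and> A' y z \<noteq> 0}"
    \<comment> \<open>Distance from the wrong neighbours \<open>M\<close> of \<open>i\<close> in the
      graph of nonzero entries on \<open>K\<close>; meaningful only for reachable vertices, hence
      the premise of \<open>d_in\<close>.\<close>
    define d where "d y = (LEAST n. y \<in> (E ^^ n) `` M)" for y
    define S where "S = E\<^sup>* `` M"
    have d_le: "d y \<le> n" if "y \<in> (E ^^ n) `` M" for y n
      unfolding d_def using that by (rule Least_le)
    have in_S: "y \<in> S" if "y \<in> (E ^^ n) `` M" for y n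
      using that by (auto simp: S_def Image_iff rtrancl_power)
    have d_in: "y \<in> (E ^^ d y) `` M" if y: "y \<in> S" for y
    proof -
      have "\<exists>n. y \<in> (E ^^ n) `` M"
        using y by (auto simp: S_def Image_iff rtrancl_power)
      then obtain n where "y \<in> (E ^^ n) `` M" ..
      then show ?thesis unfolding d_def by (rule LeastI)
    qed
    have SK: "S \<subseteq> K"
    proof
      fix y assume "y \<in> S"
      then obtain z where "z \<in> M" "(z, y) \<in> E\<^sup>*" by (auto simp: S_def)
      then show "y \<in> K" by (auto elim: rtranclE simp: M_def E_def)
    qed
    have no_plus: False if y: "y \<in> S" "A' i y \<noteq> 0" "B i y = A' i y" for y
    proof -
      \<comment> \<open>A shortest path from \<open>M\<close> to a nearest right neighbour
        \<open>w\<close>, closed up through \<open>i\<close>, is the cycle to be refuted.\<close>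
      define Q where "Q y \<longleftrightarrow> y \<in> S \<and> A' i y \<noteq> 0 \<and> B i y = A' i y" for y
      obtain w where w: "Q w" and w_min: "\<And>z. Q z \<Longrightarrow> d w \<le> d z"
        using y ex_has_least_nat[of Q y d] by (auto simp: Q_def)
      define m where "m = d w"
      obtain x0 where x0: "x0 \<in> M" "(x0, w) \<in> E ^^ m"
        using d_in[of w] w by (auto simp: Q_def m_def)
      obtain x where x: "x 0 = x0" "x m = w" "\<And>k. k < m \<Longrightarrow> (x k, x (Suc k)) \<in> E"
        using x0(2) unfolding relpow_fun_conv by blast
      have pre: "x k \<in> (E ^^ k) `` M" if "k \<le> m" for k
      proof -
        have "(x0, x k) \<in> E ^^ k"
          unfolding relpow_fun_conv using x that by (intro exI[of _ x]) auto
        then show ?thesis using x0 by blast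
      qed
      \<comment> \<open>A shortcut to \<open>x k\<close> would shorten the way to \<open>w\<close>.
        Exact distances give both the injectivity of \<open>x\<close> and the absence of
        chords.\<close>
      have dx: "d (x k) = k" if k: "k \<le> m" for k
      proof (rule antisym)
        show "d (x k) \<le> k" by (rule d_le[OF pre[OF k]])
        have "(x k, w) \<in> E ^^ (m - k)"
          unfolding relpow_fun_conv using x k by (intro exI[of _ "\<lambda>l. x (k + l)"]) auto
        moreover have "x k \<in> (E ^^ d (x k)) `` M"
          by (rule d_in[OF in_S[OF pre[OF k]]])
        ultimately have "w \<in> (E ^^ (d (x k) + (m - k))) `` M"
          unfolding relpow_add by auto
        then have "m \<le> d (x k) + (m - k)" unfolding m_def by (rule d_le)
        then show "k \<le> d (x k)" using k by linarith
      qed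
      have m: "m > 0"
      proof (rule Nat.gr0I)
        assume "m = 0"
        then have "w \<in> M" using x x0 by simp
        then show False using w by (auto simp: M_def Q_def)
      qed
      have xK: "x k \<in> K" if "k \<le> m" for k
        using in_S[OF pre[OF that]] SK by blast
      \<comment> \<open>An inner neighbour of \<open>i\<close> would either lie in \<open>M\<close>,
        at distance 0, or be a right neighbour nearer than \<open>w\<close>.\<close>
      have inner: "A' i (x k) = 0" if k: "0 < k" "k < m" for k
      proof (rule ccontr)
        assume nz: "A' i (x k) \<noteq> 0"
        have "x k \<in> K" using xK k by simp
        then consider "x k \<in> M" | "B i (x k) = A' i (x k)"
          using abs_eq nz by (auto simp: M_def)
        then show False
        proof cases
          case 1
          then have "d (x k) \<le> 0" by (intro d_le) simp
          then show False using dx[of k] k by simp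
        next
          case 2
          then have "Q (x k)"
            using nz in_S[OF pre[of k]] k by (simp add: Q_def)
          then show False using w_min dx[of k] k by (force simp: m_def)
        qed
      qed
      define J where "J = insert i (x ` {..m})"
      have "principal_minor J A' \<noteq> principal_minor J B"
        unfolding J_def
      proof (rule principal_minor_chordless_cycle[OF m])
        show "inj_on x {..m}" using dx by (metis inj_onI atMost_iff)
        show "i \<notin> x ` {..m}" using xK insert.hyps by auto
        show "A' (x k) (x l) = 0" if kl: "Suc k < l" "l \<le> m" for k l
        proof (rule ccontr)
          assume "A' (x k) (x l) \<noteq> 0"
          then have "(x k, x l) \<in> E" using xK kl by (simp add: E_def)
          then have "x l \<in> (E ^^ Suc k) `` M" using pre[of k] kl by auto
          then show False using d_le[of "x l" "Suc k"] dx[of l] kl by simp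
        qed
        show "A' (x k) (x (Suc k)) \<noteq> 0" if "k < m" for k
          using x(3)[OF that] by (simp add: E_def)
        show "A' i (x 0) \<noteq> 0" using x0 x by (simp add: M_def)
        show "A' i (x m) \<noteq> 0" using w x by (simp add: Q_def)
        show "A' i (x k) = 0" if "0 < k" "k < m" for k using inner[OF that] .
        have Bi: "B i (x k) = (if k = 0 then - A' i (x k) else A' i (x k))" if k: "k \<le> m" for k
        proof -
          consider "k = 0" | "0 < k" "k < m" | "k = m" using k by linarith
          then show ?thesis
          proof cases
            case 1
            then show ?thesis using x0 x by (simp add: M_def)
          next
            case 2
            then show ?thesis using inner[of k] abs_eq[OF xK[of k]] by simp
          next
            case 3
            then show ?thesis using w x m by (simp add: Q_def)
          qed
        qed
        have x0i: "x k = x 0 \<longleftrightarrow> k = 0" "x k \<noteq> i" if "k \<le> m" for k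
          using dx[of k] dx[of 0] xK[OF that] insert.hyps that by auto
        show "B y z = (if {y, z} = {i, x 0} then - A' y z else A' y z)"
          if yz: "y \<in> insert i (x ` {..m})" "z \<in> insert i (x ` {..m})" for y z
        proof -
          consider "y = i" "z = i" | k where "k \<le> m" "y = i" "z = x k"
            | k where "k \<le> m" "y = x k" "z = i" | k l where "k \<le> m" "l \<le> m" "y = x k" "z = x l"
            using yz by auto
          then show ?thesis
          proof cases
            case 1
            then show ?thesis using diag[of i] x0i(2)[of 0] by (auto simp: doubleton_eq_iff)
          next
            case 2
            then show ?thesis using Bi[of k] x0i[of k] x0i[of 0] by (auto simp: doubleton_eq_iff)
          next
            case 3
            then show ?thesis
              using Bi[of k] x0i[of k] x0i[of 0] symB[of y z] symA'[of y z] by (auto simp: doubleton_eq_iff)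
          next
            case 4
            then show ?thesis using A'K[OF xK xK, of k l] x0i[of k] x0i[of l] by (auto simp: doubleton_eq_iff)
          qed
        qed
      qed (rule symA')
      moreover have "J \<subseteq> insert i K" using xK by (auto simp: J_def)
      ultimately show False using minors[of J] by (simp add: J_def)
    qed
    have S_edge: "y \<in> S \<longleftrightarrow> z \<in> S" if "y \<in> K" "z \<in> K" "A' y z \<noteq> 0" for y z
    proof -
      have "(y, z) \<in> E" "(z, y) \<in> E" using that symA'[of y z] by (auto simp: E_def)
      then show ?thesis unfolding S_def by (meson Image_iff rtrancl.rtrancl_into_rtrancl)
    qed
    have iS: "i \<notin> S" using SK insert.hyps by auto
    have Bi: "B i y = (if y \<in> S then - A' i y else A' i y)" if y: "y \<in> K" for y
    proof (cases "A' i y = 0")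
      case True
      then show ?thesis using abs_eq[OF y] by auto
    next
      case False
      have "y \<in> S" if "B i y = - A' i y"
        using that False y by (auto simp: S_def M_def)
      then show ?thesis using no_plus[of y] False abs_eq[OF y] by auto
    qed
    \<comment> \<open>No nonzero entry joins \<open>S\<close> to \<open>K - S\<close>, so this
      change corrects row \<open>i\<close> and leaves the agreement on \<open>K\<close>
      intact.\<close>
    define \<eta> where "\<eta> y = (if y \<in> S then - \<epsilon> y else \<epsilon> y)" for y
    have A'\<eta>: "\<eta> y * \<eta> z * A y z = (if y \<in> S \<longleftrightarrow> z \<in> S then A' y z else - A' y z)" for y z
      by (simp add: \<eta>_def A'_def)
    show ?case
    proof (intro exI[of _ \<eta>] conjI allI ballI)
      show "\<eta> y \<in> {1, -1}" for y using \<epsilon>[of y] by (auto simp: \<eta>_def)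
      fix y z assume "y \<in> insert i K" "z \<in> insert i K"
      then consider "y = i" "z = i" | "y = i" "z \<in> K" | "y \<in> K" "z = i" | "y \<in> K" "z \<in> K" by auto
      then show "B y z = \<eta> y * \<eta> z * A y z"
        unfolding A'\<eta>
      proof cases
        case 1
        then show "B y z = (if y \<in> S \<longleftrightarrow> z \<in> S then A' y z else - A' y z)" using diag[of i] by simp
      next
        case 2
        then show "B y z = (if y \<in> S \<longleftrightarrow> z \<in> S then A' y z else - A' y z)" using Bi iS by simp
      next
        case 3
        then show "B y z = (if y \<in> S \<longleftrightarrow> z \<in> S then A' y z else - A' y z)"
          using Bi iS symB[of y z] symA'[of y z] by simp
      next
        case 4
        then show "B y z = (if y \<in> S \<longleftrightarrow> z \<in> S then A' y z else - A' y z)"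
          using A'K S_edge by (cases "A' y z = 0") auto
      qed
    qed
  qed
  then show ?thesis using that by blast
qed

theorem corollary1p5:
  fixes n :: nat
    and v w :: "nat \<Rightarrow> 'a::{real_inner, complete_space}"
  assumes "independent_family {1..n} v"
    and "independent_family {1..n} w"
    and "\<And>I. I \<subseteq> {1..n} \<Longrightarrow> I \<noteq> {} \<Longrightarrow>
           parallelepiped_volume I v = parallelepiped_volume I w"
  shows "isometric (parallelepiped {1..n} v) (parallelepiped {1..n} w)"
proof -
  have "principal_minor I (\<lambda>i j. v i \<bullet> v j) = principal_minor I (\<lambda>i j. w i \<bullet> w j)"
    if "I \<subseteq> {1..n}" "I \<noteq> {}" for I
    using gram_eq_if_pvol_eq[of I v w] finite_subset[OF that(1)] assms(3)[OF that]
    by (simp add: pvol_def cross_gram_def)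
  then obtain \<epsilon> where "\<And>i. \<epsilon> i \<in> {1, -1}"
    "\<And>i j. i \<in> {1..n} \<Longrightarrow> j \<in> {1..n} \<Longrightarrow> w i \<bullet> w j = \<epsilon> i * \<epsilon> j * (v i \<bullet> v j)"
    by (rule equal_principal_minors_imp_switching[of "{1..n}" "\<lambda>i j. v i \<bullet> v j" "\<lambda>i j. w i \<bullet> w j", rotated 3])
      (auto simp: inner_commute)
  then show ?thesis by (intro isometric_parallelepiped[of _ \<epsilon>]) auto
qed

end
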